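(* Let $\Omega\subset\mathbb{R}^d$ be a bounded Lebesgue measurable set and let $g_1,\dots,g_q$ be a finite set of functions in $L^2(\Omega)\setminus\{0\}$. Let $J=\{j\in\{1,\dots,q\}:\|g_j\|_\infty<\infty\}$. Then there exist countable sets $\Lambda_1,\dots,\Lambda_q\subset\mathbb{R}^d$ such that $\bigcup_{j=1}^{q}\mathcal{E}(g_j,\Lambda_j)$ forms a frame for $L^2(\Omega)$ if and only if there exists $m>0$ such that $$\max_{j\in J}|g_j|\ge m\quad\text{almost everywhere on }\Omega .$$
   Context: $\|g_j\|_\infty$ is the essential supremum of $|g_j|$ on $\Omega$. A maximum over the empty index set is taken to be $0$ (so the condition fails if $J=\emptyset$). For $g_j\in L^2(\Omega)\setminus\{0\}$ and countable $\Lambda_j\subset\mathbb{R}^d$, $\mathcal{E}(g_j,\Lambda_j)=\{g_j(x)e^{2\pi i\langle\lambda,x\rangle}:\lambda\in\Lambda_j\}$. The collection $\bigcup_{j=1}^q\mathcal{E}(g_j,\Lambda_j)$ (indexed by pairs $(j,\lambda)$, $\lambda\in\Lambda_j$) is a frame for $L^2(\Omega)$ if there exist constants $0<A,B<\infty$ such that for all $f\in L^2(\Omega)$ $$A\|f\|_{L^2(\Omega)}^2\le\sum_{j=1}^q\sum_{\lambda\in\Lambda_j}\left|\int_\Omega f(x)\overline{g_j(x)}e^{-2\pi i\langle\lambda,x\rangle}dx\right|^2\le B\|f\|_{L^2(\Omega)}^2 .$$ *)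

theory Defs
  imports "HOL-Probability.Essential_Supremum"
begin

text \<open>Elements of \<open>L\<^sup>2(\<Omega>)\<close> are represented by functions on the whole space; only their values on
  \<open>\<Omega>\<close> matter, and the zero class consists of the functions vanishing almost everywhere on \<open>\<Omega>\<close>.\<close>

definition L2 :: "(real ^ 'd) set \<Rightarrow> (real ^ 'd \<Rightarrow> complex) set" where
  "L2 \<Omega> = {f. f \<in> borel_measurable (lebesgue_on \<Omega>) \<and>
              integrable (lebesgue_on \<Omega>) (\<lambda>x. (cmod (f x))\<^sup>2)}"

definition L2_zero :: "(real ^ 'd) set \<Rightarrow> (real ^ 'd \<Rightarrow> complex) set" where
  "L2_zero \<Omega> = {f \<in> L2 \<Omega>. AE x in lebesgue_on \<Omega>. f x = 0}"

definition L2_norm :: "(real ^ 'd) set \<Rightarrow> (real ^ 'd \<Rightarrow> complex) \<Rightarrow> real" where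
  "L2_norm \<Omega> f = sqrt (LINT x|lebesgue_on \<Omega>. (cmod (f x))\<^sup>2)"

definition Linf_norm :: "(real ^ 'd) set \<Rightarrow> (real ^ 'd \<Rightarrow> complex) \<Rightarrow> ennreal" where
  "Linf_norm \<Omega> g = esssup (lebesgue_on \<Omega>) (\<lambda>x. ennreal (cmod (g x)))"

definition weighted_exp :: "(real ^ 'd \<Rightarrow> complex) \<Rightarrow> real ^ 'd \<Rightarrow> real ^ 'd \<Rightarrow> complex" where
  "weighted_exp g l x = g x * exp (2 * complex_of_real pi * \<i> * complex_of_real (l \<bullet> x))"

definition L2_inner :: "(real ^ 'd) set \<Rightarrow> (real ^ 'd \<Rightarrow> complex) \<Rightarrow> (real ^ 'd \<Rightarrow> complex) \<Rightarrow> complex" where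
  "L2_inner \<Omega> f h = (LINT x|lebesgue_on \<Omega>. f x * cnj (h x))"

text \<open>The sum of the squared coefficients is taken in \<^typ>\<open>ennreal\<close>, where it always exists (so a
  divergent sum is \<open>\<infinity>\<close>, and the upper bound then fails). As the sum runs over pairs
  \<open>(j, l)\<close>, coinciding functions are counted with multiplicity.\<close>

definition is_weighted_exp_frame ::
  "(real ^ 'd) set \<Rightarrow> nat \<Rightarrow> (nat \<Rightarrow> real ^ 'd \<Rightarrow> complex) \<Rightarrow> (nat \<Rightarrow> (real ^ 'd) set) \<Rightarrow> bool" where
  "is_weighted_exp_frame \<Omega> q g \<Lambda> \<longleftrightarrow>
     (\<exists>A B :: real. A > 0 \<and> B > 0 \<and>
       (\<forall>f \<in> L2 \<Omega>.
          ennreal (A * (L2_norm \<Omega> f)\<^sup>2)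
            \<le> (\<Sum>j = 1..q. \<Sum>\<^sub>\<infinity>l\<in>\<Lambda> j. ennreal ((cmod (L2_inner \<Omega> f (weighted_exp (g j) l)))\<^sup>2)) \<and>
          (\<Sum>j = 1..q. \<Sum>\<^sub>\<infinity>l\<in>\<Lambda> j. ennreal ((cmod (L2_inner \<Omega> f (weighted_exp (g j) l)))\<^sup>2))
            \<le> ennreal (B * (L2_norm \<Omega> f)\<^sup>2)))"

text \<open>\<^const>\<open>Max\<close> is unspecified on the empty set; the convention here is \<open>0\<close>.\<close>

definition max_over :: "nat set \<Rightarrow> (nat \<Rightarrow> real) \<Rightarrow> real" where
  "max_over J a = (if J = {} then 0 else Max (a ` J))"

end

theory Submission
  imports Defs
begin

text \<open>Write \<open>h\<^sub>j = f \<cdot> cnj g\<^sub>j\<close>; the coefficients of \<open>f\<close> are the values of the Fourier transform of \<open>h\<^sub>j\<close> on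
  \<open>\<Lambda>\<^sub>j\<close>. If \<open>max |g\<^sub>j| \<ge> m\<close> over \<open>J\<close>, take a common lattice for the \<open>\<Lambda>\<^sub>j\<close> with \<open>j \<in> J\<close> (Parseval on a cube
  containing \<open>\<Omega>\<close>) and the empty set otherwise.

  Conversely, modulate \<open>f\<close> by a frequency \<open>\<xi>\<close> and average over large balls of \<open>\<xi>\<close>. Integrating the
  upper frame bound for \<open>f = 1\<^sub>S / cnj g\<^sub>j\<close>, \<open>S = {|g\<^sub>j| \<ge> T}\<close>, bounds the upper Beurling density of
  \<open>\<Lambda>\<^sub>j\<close> by a constant times \<open>B / T\<^sup>2\<close>, so it is finite for all \<open>j\<close> and zero when \<open>g\<^sub>j\<close> is unbounded.
  Integrating the lower frame bound gives \<open>A \<parallel>f\<parallel>\<^sup>2 \<le> \<Sum>\<^sub>j D\<^sub>j \<parallel>h\<^sub>j\<parallel>\<^sup>2\<close> with these densities \<open>D\<^sub>j\<close>; only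
  \<open>j \<in> J\<close> contributes, and indicator functions \<open>f\<close> localise the inequality.\<close>

section \<open>Square-integrable functions and characters\<close>

text \<open>No density is ever defined as a limit. A count of the frequencies in balls of one large
  radius L, uniform in the centre, serves all j at once, and the ball volume cancels at the end.
  Turning the upper frame bound into such a count loses mass near the boundary of a ball. Doubling
  the radius and keeping half of the mass repairs this at the cost of constants only. The averaged
  lower bound has no such loss: after the substitution u = l + \<xi>, each u is weighted by the
  number of frequencies in the ball of radius L about u.

  The obstacle is an unbounded g_j: f * cnj g_j must be square-integrable before Plancherel applies,
  so f is supported where every |g_j| is at most n. For j outside \<open>J\<close> the threshold T
  is chosen after n, so large that the term n^2 / T^2 is negligible. For j in \<open>J\<close> the
  threshold is fixed once; a positive one exists because g_j is not the zero class, and a vanishing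
  g_j would put no restriction on its frequencies.\<close>

text \<open>Makes sums over frequencies accessible to Tonelli, so that they can be exchanged with
  integrals over the modulation parameter.\<close>

lemma infsum_eq_nn_integral_count_space:
  fixes f :: "'a \<Rightarrow> ennreal"
  assumes "countable A"
  shows "infsum f A = (\<integral>\<^sup>+ x. f x \<partial>count_space A)"
proof (cases "finite A")
  case True
  then show ?thesis by (simp add: nn_integral_count_space_finite)
next
  case False
  define b where "b = from_nat_into A"
  have b: "bij_betw b UNIV A"
    using assms False unfolding b_def by (rule bij_betw_from_nat_into)
  have "(\<integral>\<^sup>+ x. f x \<partial>count_space A) = (\<Sum>n. f (b n))"
    using nn_integral_bij_count_space[OF b, of f] nn_integral_count_space_nat[of "\<lambda>n. f (b n)"] by simp
  moreover have "(\<Sum>n. f (b n)) = infsum f A"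
  proof -
    have "((\<lambda>n. f (b n)) has_sum infsum (\<lambda>n. f (b n)) UNIV) UNIV"
      by (rule has_sum_infsum) (rule nonneg_summable_on_complete, simp)
    then have "(\<lambda>n. f (b n)) sums infsum (\<lambda>n. f (b n)) UNIV"
      by (rule has_sum_imp_sums)
    then show ?thesis
      using infsum_reindex_bij_betw[OF b, of f] by (simp add: sums_iff)
  qed
  ultimately show ?thesis by simp
qed

text \<open>\<open>lborel\<close> is the image of a product of one-dimensional measures under the
  coordinate map, so Fubini applies. This reduces orthogonality of characters on a cube to one
  dimension.\<close>

lemma lborel_integral_prod:
  fixes f :: "'a::euclidean_space \<Rightarrow> real \<Rightarrow> 'b::{real_normed_field,banach,second_countable_topology}"
  assumes "\<And>b. b \<in> Basis \<Longrightarrow> integrable lborel (f b)"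
  shows "(LINT x|lborel. (\<Prod>b\<in>Basis. f b (x \<bullet> b))) = (\<Prod>b\<in>Basis. (LINT t|lborel. f b t))"
proof -
  interpret product_sigma_finite "\<lambda>_::'a. lborel :: real measure" ..
  have m [measurable]: "f b \<in> borel_measurable borel" if "b \<in> Basis" for b
    using borel_measurable_integrable[OF assms[OF that]] by simp
  have "(LINT x|lborel. (\<Prod>b\<in>Basis. f b (x \<bullet> b)))
      = (LINT x|distr (\<Pi>\<^sub>M b\<in>Basis. lborel) borel (\<lambda>f. \<Sum>b\<in>Basis. f b *\<^sub>R b). (\<Prod>b\<in>Basis. f b (x \<bullet> b)))"
    by (subst lborel_eq) simp
  also have "\<dots> = (LINT y|(\<Pi>\<^sub>M b\<in>Basis. lborel). (\<Prod>b\<in>Basis. f b ((\<Sum>c\<in>Basis. y c *\<^sub>R c) \<bullet> b)))"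
    by (subst integral_distr) simp_all
  also have "\<dots> = (LINT y|(\<Pi>\<^sub>M b\<in>Basis. lborel). (\<Prod>b\<in>Basis. f b (y b)))"
    by (intro Bochner_Integration.integral_cong refl prod.cong) simp
  also have "\<dots> = (\<Prod>b\<in>Basis. (LINT t|lborel. f b t))"
    by (rule product_integral_prod) (use assms in auto)
  finally show ?thesis .
qed

lemma L2_measurable: "f \<in> L2 \<Omega> \<Longrightarrow> f \<in> borel_measurable (lebesgue_on \<Omega>)"
  and L2_integrable: "f \<in> L2 \<Omega> \<Longrightarrow> integrable (lebesgue_on \<Omega>) (\<lambda>x. (cmod (f x))\<^sup>2)"
  by (auto simp: L2_def)

lemma L2_norm_power2: "(L2_norm \<Omega> f)\<^sup>2 = (LINT x|lebesgue_on \<Omega>. (cmod (f x))\<^sup>2)"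
  by (simp add: L2_norm_def)

lemma L2_mult_integrable:
  assumes "f \<in> L2 \<Omega>" "g \<in> L2 \<Omega>"
  shows "integrable (lebesgue_on \<Omega>) (\<lambda>x. f x * g x)"
proof (rule Bochner_Integration.integrable_bound)
  note [measurable] = assms[THEN L2_measurable]
  show "integrable (lebesgue_on \<Omega>) (\<lambda>x. (cmod (f x))\<^sup>2 + (cmod (g x))\<^sup>2)"
    using assms by (intro Bochner_Integration.integrable_add L2_integrable)
  show "(\<lambda>x. f x * g x) \<in> borel_measurable (lebesgue_on \<Omega>)" by measurable
  have "cmod (f x) * cmod (g x) \<le> (cmod (f x))\<^sup>2 + (cmod (g x))\<^sup>2" for x
    using sum_squares_bound[of "cmod (f x)" "cmod (g x)"]
      mult_nonneg_nonneg[OF norm_ge_zero[of "f x"] norm_ge_zero[of "g x"]] by linarith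
  then show "AE x in lebesgue_on \<Omega>. norm (f x * g x) \<le> norm ((cmod (f x))\<^sup>2 + (cmod (g x))\<^sup>2)"
    by (simp add: norm_mult)
qed

lemma L2_bounded_mult:
  assumes "f \<in> L2 \<Omega>" "g \<in> borel_measurable (lebesgue_on \<Omega>)"
    and "AE x in lebesgue_on \<Omega>. cmod (g x) \<le> C"
  shows "(\<lambda>x. f x * g x) \<in> L2 \<Omega>"
proof -
  note [measurable] = assms(2) assms(1)[THEN L2_measurable]
  have "integrable (lebesgue_on \<Omega>) (\<lambda>x. (cmod (f x * g x))\<^sup>2)"
  proof (rule Bochner_Integration.integrable_bound)
    show "integrable (lebesgue_on \<Omega>) (\<lambda>x. C\<^sup>2 * (cmod (f x))\<^sup>2)"
      using L2_integrable[OF assms(1)] by simp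
    show "AE x in lebesgue_on \<Omega>. norm ((cmod (f x * g x))\<^sup>2) \<le> norm (C\<^sup>2 * (cmod (f x))\<^sup>2)"
      using assms(3)
    proof eventually_elim
      case (elim x)
      then have "(cmod (g x))\<^sup>2 \<le> C\<^sup>2" by (intro power_mono) auto
      then show ?case by (simp add: norm_mult power_mult_distrib mult_right_mono mult.commute[of "C\<^sup>2"] mult_left_mono)
    qed
  qed measurable
  then show ?thesis by (simp add: L2_def)
qed

lemma lebesgue_on_bounded_finite:
  assumes "bounded S" "S \<in> sets lebesgue"
  shows "finite_measure (lebesgue_on S)"
  using bounded_set_imp_lmeasurable[OF assms]
  by (intro finite_measure_lebesgue_on) auto

lemma L2_bounded:
  assumes "finite_measure (lebesgue_on S)" "f \<in> borel_measurable (lebesgue_on S)"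
    and "\<And>x. x \<in> S \<Longrightarrow> cmod (f x) \<le> C"
  shows "f \<in> L2 S"
proof -
  interpret finite_measure "lebesgue_on S" by fact
  note [measurable] = assms(2)
  have "integrable (lebesgue_on S) (\<lambda>x. (cmod (f x))\<^sup>2)"
    by (rule integrable_const_bound[where B = "C\<^sup>2"])
      (use assms(3) in \<open>auto intro!: power_mono AE_I2\<close>)
  then show ?thesis using assms by (simp add: L2_def)
qed

lemma cmod_add_power2_le: "(cmod (z + w))\<^sup>2 \<le> 2 * ((cmod z)\<^sup>2 + (cmod w)\<^sup>2)"
proof -
  have "(cmod (z + w))\<^sup>2 \<le> (cmod z + cmod w)\<^sup>2"
    by (intro power_mono norm_triangle_ineq) auto
  also have "\<dots> \<le> 2 * ((cmod z)\<^sup>2 + (cmod w)\<^sup>2)"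
    using sum_squares_bound[of "cmod z" "cmod w"] by (simp add: power2_sum)
  finally show ?thesis .
qed

lemma L2_add:
  assumes "f \<in> L2 \<Omega>" "g \<in> L2 \<Omega>" shows "(\<lambda>x. f x + g x) \<in> L2 \<Omega>"
proof -
  note [measurable] = assms[THEN L2_measurable]
  have "integrable (lebesgue_on \<Omega>) (\<lambda>x. (cmod (f x + g x))\<^sup>2)"
  proof (rule Bochner_Integration.integrable_bound)
    show "integrable (lebesgue_on \<Omega>) (\<lambda>x. 2 * ((cmod (f x))\<^sup>2 + (cmod (g x))\<^sup>2))"
      using assms[THEN L2_integrable] by simp
    show "AE x in lebesgue_on \<Omega>. norm ((cmod (f x + g x))\<^sup>2)
        \<le> norm (2 * ((cmod (f x))\<^sup>2 + (cmod (g x))\<^sup>2))"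
      using cmod_add_power2_le by simp
  qed measurable
  then show ?thesis by (simp add: L2_def)
qed

lemma cnj_measurable [measurable]: "cnj \<in> borel_measurable borel"
  by (intro borel_measurable_continuous_onI continuous_intros)

lemma L2_cnj: "f \<in> L2 \<Omega> \<Longrightarrow> (\<lambda>x. cnj (f x)) \<in> L2 \<Omega>"
  by (auto simp: L2_def)

definition echar :: "real ^ 'd \<Rightarrow> real ^ 'd \<Rightarrow> complex" where
  "echar k x = cis (2 * pi * (k \<bullet> x))"

lemma norm_echar [simp]: "cmod (echar k x) = 1"
  by (simp add: echar_def)

lemma echar_add: "echar (k + l) x = echar k x * echar l x"
  by (simp add: echar_def cis_mult inner_add_left ring_distribs)

lemma echar_minus: "echar (- k) x = cnj (echar k x)"
  by (simp add: echar_def cis_cnj)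

lemma echar_diff: "echar (k - l) x = echar k x * cnj (echar l x)"
  using echar_add[of k "- l" x] by (simp add: echar_minus)

lemma echar_0 [simp]: "echar 0 x = 1"
  by (simp add: echar_def)

lemma continuous_echar [continuous_intros]:
  "continuous_on S f \<Longrightarrow> continuous_on S g \<Longrightarrow> continuous_on S (\<lambda>x. echar (f x) (g x))"
  unfolding echar_def cis_conv_exp by (intro continuous_intros)

lemma echar_measurable [measurable]: "case_prod echar \<in> borel_measurable borel"
  by (intro borel_measurable_continuous_onI) (auto simp: case_prod_beta intro!: continuous_intros)

lemma echar_measurable_borel [measurable]: "echar k \<in> borel_measurable borel"
  using continuous_echar[of UNIV "\<lambda>_. k" "\<lambda>x. x"]
  by (auto intro!: borel_measurable_continuous_onI)

lemma echar_measurable_lebesgue_on [measurable]: "echar k \<in> borel_measurable (lebesgue_on S)"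
  by (intro measurable_restrict_space1 measurable_completion) simp

text \<open>The Fourier transform of the extension of \<open>h\<close> by zero off \<Omega>. It is
  applied to products f * cnj g of two \<open>L2\<close> functions, which are integrable by
  \<open>L2_mult_integrable\<close>, so the default value of the integral does not intervene
  there.\<close>

definition ft :: "(real ^ 'd) set \<Rightarrow> (real ^ 'd \<Rightarrow> complex) \<Rightarrow> real ^ 'd \<Rightarrow> complex" where
  "ft \<Omega> h \<eta> = (LINT x|lebesgue_on \<Omega>. h x * cnj (echar \<eta> x))"

lemma L2_inner_weighted_exp: "L2_inner \<Omega> f (weighted_exp g l) = ft \<Omega> (\<lambda>x. f x * cnj (g x)) l"
proof -
  have *: "exp (2 * complex_of_real pi * \<i> * complex_of_real t) = cis (2 * pi * t)" for t
    by (simp add: cis_conv_exp mult_ac)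
  show ?thesis
    unfolding L2_inner_def weighted_exp_def ft_def echar_def * by (simp add: mult.assoc)
qed

section \<open>Fourier series on a cube\<close>

definition cube :: "real \<Rightarrow> (real ^ 'd) set" where
  "cube N = cbox (\<chi> i. - N) (\<chi> i. N)"

text \<open>\<open>lat N\<close> consists of the frequencies \<open>k\<close> for which \<open>echar k\<close> has period \<open>2N\<close> in each coordinate.\<close>

definition lat :: "real \<Rightarrow> (real ^ 'd) set" where
  "lat N = {k. \<forall>i. 2 * N * (k $ i) \<in> \<int>}"

lemma mem_cube_Basis: "x \<in> cube N \<longleftrightarrow> (\<forall>b\<in>Basis. x \<bullet> b \<in> {- N..N})"
  by (auto simp: cube_def mem_box Basis_vec_def inner_axis)

lemma mem_lat_Basis: "k \<in> lat N \<longleftrightarrow> (\<forall>b\<in>Basis. 2 * N * (k \<bullet> b) \<in> \<int>)"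
  by (auto simp: lat_def Basis_vec_def inner_axis)

lemma cube_sets [measurable]: "cube N \<in> sets borel"
  by (simp add: cube_def)

lemma cube_sets_lebesgue [simp]: "cube N \<in> sets lebesgue"
  by (simp add: cube_def)

lemma emeasure_cube:
  assumes "N > 0"
  shows "emeasure lebesgue (cube N :: (real ^ 'd) set) = ennreal ((2 * N) ^ CARD('d))"
  unfolding cube_def using assms
  by (subst emeasure_completion) (auto simp: emeasure_lborel_cbox_eq inner_axis Basis_vec_def
      prod.UNION_disjoint axis_eq_axis prod_constant card_image inj_on_def
      simp flip: prod_constant)

lemma finite_measure_cube: "finite_measure (lebesgue_on (cube N))"
  by (intro lebesgue_on_bounded_finite) (auto simp: cube_def bounded_cbox)

lemma lat_diff: "k \<in> lat N \<Longrightarrow> l \<in> lat N \<Longrightarrow> k - l \<in> lat N"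
  and lat_add: "k \<in> lat N \<Longrightarrow> l \<in> lat N \<Longrightarrow> k + l \<in> lat N"
  and lat_0: "0 \<in> lat N"
  by (auto simp: lat_def ring_distribs)

lemma lat_countable:
  assumes "N > 0" shows "countable (lat N :: (real ^ 'd) set)"
proof (rule countable_subset)
  show "lat N \<subseteq> range (\<lambda>f :: 'd \<Rightarrow> int. \<chi> i. of_int (f i) / (2 * N))"
  proof
    fix k :: "real ^ 'd" assume k: "k \<in> lat N"
    have "k = (\<chi> i. of_int \<lfloor>2 * N * (k $ i)\<rfloor> / (2 * N))"
      using k assms by (auto simp: lat_def vec_eq_iff floor_of_int elim!: Ints_cases dest!: spec)
    then show "k \<in> range (\<lambda>f :: 'd \<Rightarrow> int. \<chi> i. of_int (f i) / (2 * N))"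
      by (rule range_eqI[where x = "\<lambda>i. \<lfloor>2 * N * (k $ i)\<rfloor>"])
  qed
  show "countable (range (\<lambda>f :: 'd \<Rightarrow> int. (\<chi> i. of_int (f i) / (2 * N)) :: real ^ 'd))"
    by simp
qed

lemma integral_cis_interval:
  assumes "N > 0" "2 * N * \<kappa> \<in> \<int>"
  shows "(LINT t|lborel. indicator {-N..N} t * cis (2 * pi * (\<kappa> * t))) = (if \<kappa> = 0 then 2 * N else 0)"
proof (cases "\<kappa> = 0")
  case True
  have "(LINT t|lborel. indicator {-N..N} t * (1::complex)) = (LINT t|lborel. indicat_real {-N..N} t *\<^sub>R (1::complex))"
    by (intro Bochner_Integration.integral_cong) (auto simp: indicator_def)
  also have "\<dots> = complex_of_real (2 * N)"
    using assms by (simp add: of_real_def)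
  finally show ?thesis using True by simp
next
  case False
  define F where "F t = cis (2 * pi * (\<kappa> * t)) / (2 * pi * \<kappa> * \<i>)" for t
  have "(LINT t|lborel. indicator {-N..N} t * cis (2 * pi * (\<kappa> * t)))
      = (LINT t|lborel. indicat_real {-N..N} t *\<^sub>R cis (2 * pi * (\<kappa> * t)))"
    by (intro Bochner_Integration.integral_cong) (auto simp: indicator_def)
  also have "\<dots> = F N - F (- N)"
  proof (rule integral_FTC_atLeastAtMost)
    show "- N \<le> N" using assms by simp
    show "continuous_on {- N..N} (\<lambda>t. cis (2 * pi * (\<kappa> * t)))"
      unfolding cis_conv_exp by (intro continuous_intros)
    show "(F has_vector_derivative cis (2 * pi * (\<kappa> * t))) (at t within {- N..N})" for t
    proof -
      have "((\<lambda>z. exp (\<i> * (2 * pi * (\<kappa> * z))) / (2 * pi * \<kappa> * \<i>)) has_field_derivative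
          cis (2 * pi * (\<kappa> * t))) (at (of_real t))"
        using False by (auto intro!: derivative_eq_intros simp: cis_conv_exp field_simps)
      from has_vector_derivative_real_field[OF this] show ?thesis
        unfolding F_def cis_conv_exp by simp
    qed
  qed
  \<comment> \<open>The phases at the two endpoints differ by 2 pi times the integer 2 N \<kappa>,
    so the antiderivative \<open>F\<close> takes the same value at both.\<close>
  also have "cis (2 * pi * (\<kappa> * N)) = cis (2 * pi * (\<kappa> * (- N)))"
  proof -
    obtain n :: int where n: "2 * N * \<kappa> = of_int n" using assms by (elim Ints_cases) auto
    have "cis (2 * pi * (\<kappa> * N)) = cis (2 * pi * (\<kappa> * (- N)) + 2 * pi * of_int n)"
      by (simp add: n[symmetric] algebra_simps)
    also have "\<dots> = cis (2 * pi * (\<kappa> * (- N)))"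
      by (subst cis_mult[symmetric]) (simp add: cis_multiple_2pi)
    finally show ?thesis .
  qed
  then have "F N - F (- N) = 0" by (simp add: F_def)
  finally show ?thesis using False by simp
qed

text \<open>The integral factors over the coordinates, and a nonzero lattice frequency has a nonzero
  coordinate, whose factor is integrated over whole periods and vanishes.\<close>

lemma integral_echar_cube:
  fixes k :: "real ^ 'd"
  assumes "N > 0" "k \<in> lat N"
  shows "(LINT x|lebesgue_on (cube N). echar k x) = (if k = 0 then (2 * N) ^ CARD('d) else 0)"
proof -
  have "(LINT x|lebesgue_on (cube N). echar k x) = (LINT x|lebesgue. indicat_real (cube N) x *\<^sub>R echar k x)"
    by (subst integral_restrict_space) auto
  also have "\<dots> = (LINT x|lborel. indicat_real (cube N) x *\<^sub>R echar k x)"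
    by (rule integral_completion) measurable
  also have "\<dots> = (LINT x|lborel. (\<Prod>b\<in>Basis. indicator {-N..N} (x \<bullet> b) * cis (2 * pi * ((k \<bullet> b) * (x \<bullet> b)))))"
  proof (rule Bochner_Integration.integral_cong[OF refl])
    fix x :: "real ^ 'd"
    have "echar k x = (\<Prod>b\<in>Basis. cis (2 * pi * ((k \<bullet> b) * (x \<bullet> b))))"
      unfolding echar_def cis_conv_exp
      by (subst euclidean_inner) (simp add: exp_sum[symmetric] sum_distrib_left)
    moreover have "indicat_real (cube N) x *\<^sub>R (z::complex) = (\<Prod>b\<in>Basis. indicator {-N..N} (x \<bullet> b)) * z" for z
    proof (cases "x \<in> cube N")
      case True
      then show ?thesis by (simp add: mem_cube_Basis)
    next
      case False
      then obtain b where "b \<in> Basis" "x \<bullet> b \<notin> {-N..N}" by (auto simp: mem_cube_Basis)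
      then have "(\<Prod>b\<in>Basis. indicator {-N..N} (x \<bullet> b)) = (0::complex)"
        by (intro prod_zero) (auto simp: indicator_def)
      then show ?thesis using False by simp
    qed
    ultimately show "indicat_real (cube N) x *\<^sub>R echar k x
        = (\<Prod>b\<in>Basis. indicator {-N..N} (x \<bullet> b) * cis (2 * pi * ((k \<bullet> b) * (x \<bullet> b))))"
      by (simp add: prod.distrib)
  qed
  also have "\<dots> = (\<Prod>b\<in>Basis. (LINT t|lborel. indicator {-N..N} t * cis (2 * pi * ((k \<bullet> b) * t))))"
  proof (rule lborel_integral_prod)
    fix b :: "real ^ 'd"
    have "integrable lborel (\<lambda>t. indicat_real {-N..N} t *\<^sub>R cis (2 * pi * ((k \<bullet> b) * t)))"
      unfolding cis_conv_exp
      by (rule borel_integrable_compact) (auto intro!: continuous_intros)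
    moreover have "indicat_real {-N..N} t *\<^sub>R z = indicator {-N..N} t * z" for t and z :: complex
      by (auto simp: indicator_def)
    ultimately show "integrable lborel (\<lambda>t. indicator {-N..N} t * cis (2 * pi * ((k \<bullet> b) * t)))"
      by simp
  qed
  also have "\<dots> = (\<Prod>b\<in>(Basis :: (real ^ 'd) set). if k \<bullet> b = 0 then 2 * complex_of_real N else 0)"
    using assms by (intro prod.cong refl, subst integral_cis_interval) (auto simp: mem_lat_Basis)
  also have "\<dots> = (if k = 0 then (2 * N) ^ CARD('d) else 0)"
  proof (cases "k = 0")
    case True
    then show ?thesis by (simp add: DIM_cart)
  next
    case False
    then obtain b where "b \<in> Basis" "k \<bullet> b \<noteq> 0" using euclidean_all_zero_iff by blast
    then show ?thesis using False by (auto intro!: prod_zero)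
  qed
  finally show ?thesis .
qed

lemma echar_L2: "finite_measure (lebesgue_on S) \<Longrightarrow> echar k \<in> L2 S"
  by (rule L2_bounded[where C = 1]) auto

lemma L2_sum_echar:
  "finite_measure (lebesgue_on S) \<Longrightarrow> (\<lambda>x. \<Sum>k\<in>F. a k * echar k x) \<in> L2 S"
  by (rule L2_bounded[where C = "\<Sum>k\<in>F. cmod (a k)"]) 
    (auto intro!: order.trans[OF norm_sum] simp: norm_mult)

text \<open>Orthogonality of the characters, each of squared norm \<open>V\<close>, lets the square
  be completed in the coefficients. The factor \<open>V\<close> on the left keeps the identity free
  of division. The last sum measures how far the \<open>a k\<close> are from the Fourier
  coefficients.\<close>

lemma L2_dist_trig_sum:
  fixes h :: "real ^ 'd \<Rightarrow> complex"
  assumes N: "N > 0" and h: "h \<in> L2 (cube N)" and F: "finite F" "F \<subseteq> lat N"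
  defines "V \<equiv> (2 * N) ^ CARD('d)"
  shows "V * (LINT x|lebesgue_on (cube N). (cmod (h x - (\<Sum>k\<in>F. a k * echar k x)))\<^sup>2)
    = V * (L2_norm (cube N) h)\<^sup>2 - (\<Sum>k\<in>F. (cmod (ft (cube N) h k))\<^sup>2)
      + (\<Sum>k\<in>F. (cmod (ft (cube N) h k - V * a k))\<^sup>2)"
proof -
  let ?M = "lebesgue_on (cube N :: (real ^ 'd) set)"
  note fin = finite_measure_cube[of N, where 'a='d]
  define p where "p x = (\<Sum>k\<in>F. a k * echar k x)" for x
  have p: "p \<in> L2 (cube N)" unfolding p_def by (rule L2_sum_echar[OF fin])
  have hc: "(LINT x|?M. h x * cnj (p x)) = (\<Sum>k\<in>F. cnj (a k) * ft (cube N) h k)"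
  proof -
    have "(LINT x|?M. h x * cnj (p x)) = (LINT x|?M. (\<Sum>k\<in>F. cnj (a k) * (h x * cnj (echar k x))))"
      by (simp add: p_def sum_distrib_left mult_ac)
    also have "\<dots> = (\<Sum>k\<in>F. cnj (a k) * ft (cube N) h k)"
      unfolding ft_def
      by (subst Bochner_Integration.integral_sum) 
        (auto intro!: Bochner_Integration.integrable_mult_right L2_mult_integrable[OF h] L2_cnj echar_L2 fin)
    finally show ?thesis .
  qed
  have pp: "(LINT x|?M. p x * cnj (p x)) = (\<Sum>k\<in>F. V * (cmod (a k))\<^sup>2)"
  proof -
    have "(LINT x|?M. p x * cnj (p x)) = (LINT x|?M. (\<Sum>k\<in>F. \<Sum>l\<in>F. a k * cnj (a l) * echar (k - l) x))"
      by (simp add: p_def sum_product echar_diff mult_ac)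
    also have "\<dots> = (\<Sum>k\<in>F. \<Sum>l\<in>F. a k * cnj (a l) * (LINT x|?M. echar (k - l) x))"
    proof -
      have "integrable ?M (echar k)" for k
        using L2_mult_integrable[OF echar_L2[OF fin, of k] echar_L2[OF fin, of 0]] by simp
      then show ?thesis
        by (subst Bochner_Integration.integral_sum; simp)+
    qed
    also have "\<dots> = (\<Sum>k\<in>F. \<Sum>l\<in>F. complex_of_real (if k = l then V * (cmod (a k))\<^sup>2 else 0))"
    proof (intro sum.cong refl)
      fix k l assume "k \<in> F" "l \<in> F"
      then have "k - l \<in> lat N" using F lat_diff by blast
      then show "a k * cnj (a l) * (LINT x|?M. echar (k - l) x) = complex_of_real (if k = l then V * (cmod (a k))\<^sup>2 else 0)"
        using N by (auto simp: integral_echar_cube V_def complex_norm_square[symmetric])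
    qed
    also have "\<dots> = (\<Sum>k\<in>F. V * (cmod (a k))\<^sup>2)"
      unfolding of_real_sum[symmetric] of_real_eq_iff using F(1) by simp
    finally show ?thesis .
  qed
  have int: "integrable ?M (\<lambda>x. h x * cnj (p x))" by (intro L2_mult_integrable h L2_cnj p)
  have "(cmod (h x - p x))\<^sup>2 = (cmod (h x))\<^sup>2 - 2 * Re (h x * cnj (p x)) + (cmod (p x))\<^sup>2" for x
    by (simp add: cmod_power2 power2_diff algebra_simps)
  then have "(LINT x|?M. (cmod (h x - p x))\<^sup>2)
      = (LINT x|?M. (cmod (h x))\<^sup>2 - 2 * Re (h x * cnj (p x)) + (cmod (p x))\<^sup>2)" by simp
  also have "\<dots> = (LINT x|?M. (cmod (h x))\<^sup>2) - 2 * Re (LINT x|?M. h x * cnj (p x)) + (LINT x|?M. (cmod (p x))\<^sup>2)"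
    using int L2_integrable[OF h] L2_integrable[OF p]
    by (simp del: times_complex.sel flip: integral_Re)
  also have "(LINT x|?M. (cmod (p x))\<^sup>2) = (\<Sum>k\<in>F. V * (cmod (a k))\<^sup>2)"
  proof -
    have "complex_of_real (LINT x|?M. (cmod (p x))\<^sup>2) = (LINT x|?M. complex_of_real ((cmod (p x))\<^sup>2))"
      by (rule integral_complex_of_real[symmetric])
    also have "\<dots> = complex_of_real (\<Sum>k\<in>F. V * (cmod (a k))\<^sup>2)"
      unfolding complex_norm_square pp by simp
    finally show ?thesis by (simp only: of_real_eq_iff)
  qed
  finally have eq: "(LINT x|?M. (cmod (h x - p x))\<^sup>2) = (L2_norm (cube N) h)\<^sup>2
      - 2 * (\<Sum>k\<in>F. Re (cnj (a k) * ft (cube N) h k)) + (\<Sum>k\<in>F. V * (cmod (a k))\<^sup>2)"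
    by (simp add: hc L2_norm_power2)
  have "(cmod (c - V * a))\<^sup>2 = (cmod c)\<^sup>2 - 2 * V * Re (cnj a * c) + V * (V * (cmod a)\<^sup>2)" for c a :: complex
    by (simp add: cmod_power2 power2_diff algebra_simps) (simp add: power2_eq_square algebra_simps)
  then have "(\<Sum>k\<in>F. (cmod (ft (cube N) h k - V * a k))\<^sup>2) = (\<Sum>k\<in>F. (cmod (ft (cube N) h k))\<^sup>2)
      - 2 * V * (\<Sum>k\<in>F. Re (cnj (a k) * ft (cube N) h k)) + V * (\<Sum>k\<in>F. V * (cmod (a k))\<^sup>2)"
    by (simp add: sum.distrib sum_subtractf sum_distrib_left del: times_complex.sel)
  then show ?thesis unfolding eq[unfolded p_def] by (simp add: algebra_simps)
qed

section \<open>Trigonometric polynomials with frequencies in the lattice\<close>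

text \<open>The inductive form matches the induction over \<open>real_polynomial_function\<close>
  needed for Stone-Weierstrass. The explicit finite sums come back through
  \<open>trig_eq_sum\<close>.\<close>

inductive_set trig :: "real \<Rightarrow> (real ^ 'd \<Rightarrow> complex) set" for N where
  echar: "k \<in> lat N \<Longrightarrow> echar k \<in> trig N"
| scale: "p \<in> trig N \<Longrightarrow> (\<lambda>x. c * p x) \<in> trig N"
| add: "p \<in> trig N \<Longrightarrow> q \<in> trig N \<Longrightarrow> (\<lambda>x. p x + q x) \<in> trig N"

lemma trig_const: "(\<lambda>x. c) \<in> trig N"
  using trig.scale[OF trig.echar[OF lat_0], of c N] by simp

lemma trig_sum: "(\<And>i. i \<in> I \<Longrightarrow> p i \<in> trig N) \<Longrightarrow> (\<lambda>x. \<Sum>i\<in>I. p i x) \<in> trig N"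
  by (induction I rule: infinite_finite_induct) (auto intro: trig_const trig.add)

text \<open>Bilinearity reduces the claim to two characters, whose product has the sum of the two
  frequencies, again a point of the lattice.\<close>

lemma trig_mult:
  assumes "p \<in> trig N" "q \<in> trig N" shows "(\<lambda>x. p x * q x) \<in> trig N"
  using assms(1)
proof induction
  case (echar k)
  show ?case using assms(2)
  proof induction
    case (echar l)
    then show ?case
      using trig.echar[OF lat_add[OF \<open>k \<in> lat N\<close> echar]] by (simp add: echar_add[abs_def])
  next
    case (scale p c)
    then show ?case using trig.scale[of "\<lambda>x. echar k x * p x" N c] by (simp add: mult_ac)
  next
    case (add p q)
    then show ?case using trig.add by (simp add: ring_distribs)
  qed
next
  case (scale p c)
  then show ?case using trig.scale[of "\<lambda>x. p x * q x" N c] by (simp add: mult_ac)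
next
  case (add p q)
  then show ?case using trig.add by (simp add: ring_distribs)
qed

lemma trig_eq_sum:
  "p \<in> trig N \<Longrightarrow> \<exists>F a. finite F \<and> F \<subseteq> lat N \<and> p = (\<lambda>x. \<Sum>k\<in>F. a k * echar k x)"
proof (induction rule: trig.induct)
  case (echar k)
  then show ?case by (intro exI[of _ "{k}"] exI[of _ "\<lambda>_. 1"]) auto
next
  case (scale p c)
  then obtain F a where "finite F" "F \<subseteq> lat N" "p = (\<lambda>x. \<Sum>k\<in>F. a k * echar k x)"
    by (elim exE conjE)
  then show ?case
    by (intro exI[of _ F] exI[of _ "\<lambda>k. c * a k"]) (auto simp: sum_distrib_left mult_ac)
next
  case (add p q)
  from add.IH(1) obtain F a where
    F: "finite F" "F \<subseteq> lat N" and p: "p = (\<lambda>x. \<Sum>k\<in>F. a k * echar k x)" by (elim exE conjE)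
  from add.IH(2) obtain G b where
    G: "finite G" "G \<subseteq> lat N" and q: "q = (\<lambda>x. \<Sum>k\<in>G. b k * echar k x)" by (elim exE conjE)
  \<comment> \<open>Both coefficient families are extended by zero to the union of the frequency
    sets, so that they can be added termwise.\<close>
  have "p x = (\<Sum>k\<in>F \<union> G. (if k \<in> F then a k else 0) * echar k x)" for x
    unfolding p using F(1) G(1) by (intro sum.mono_neutral_cong_left) auto
  moreover have "q x = (\<Sum>k\<in>F \<union> G. (if k \<in> G then b k else 0) * echar k x)" for x
    unfolding q using F(1) G(1) by (intro sum.mono_neutral_cong_left) auto
  ultimately have "p x + q x = (\<Sum>k\<in>F \<union> G. ((if k \<in> F then a k else 0) + (if k \<in> G then b k else 0)) * echar k x)" for x
    by (simp only: sum.distrib[symmetric] distrib_right)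
  then have "(\<lambda>x. p x + q x) = (\<lambda>x. \<Sum>k\<in>F \<union> G. ((if k \<in> F then a k else 0) + (if k \<in> G then b k else 0)) * echar k x)"
    by (rule ext)
  moreover have "finite (F \<union> G)" "F \<union> G \<subseteq> lat N" using F G by auto
  ultimately show ?case by (intro exI conjI)
qed

lemma trig_L2: "finite_measure (lebesgue_on S) \<Longrightarrow> p \<in> trig N \<Longrightarrow> p \<in> L2 S"
  using trig_eq_sum[of p N] L2_sum_echar by auto

section \<open>Uniform approximation on the torus\<close>

text \<open>Each coordinate of period 2N is wrapped once around the unit circle. The target is a
  Euclidean space, where Stone-Weierstrass for polynomial functions is available.\<close>

definition torus_map :: "real \<Rightarrow> real ^ 'd \<Rightarrow> complex ^ 'd" where
  "torus_map N x = (\<chi> i. cis (pi * (x $ i) / N))"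

lemma continuous_torus_map: "N > 0 \<Longrightarrow> continuous_on S (torus_map N)"
  unfolding torus_map_def cis_conv_exp by (intro continuous_intros) auto

text \<open>Inside the open cube two angles of one coordinate differ by less than 2 pi. On the
  closed cube opposite faces are identified.\<close>

lemma torus_map_inj:
  fixes x y :: "real ^ 'd"
  assumes "N > 0" "x \<in> box (\<chi> i. - N) (\<chi> i. N)" "y \<in> box (\<chi> i. - N) (\<chi> i. N)"
    and "torus_map N x = torus_map N y"
  shows "x = y"
proof -
  have "x $ i = y $ i" for i
  proof -
    have "- N < x $ i" "x $ i < N" "- N < y $ i" "y $ i < N"
      using assms(2,3) by (auto simp: mem_box_cart)
    then have "\<bar>(x $ i - y $ i) / N\<bar> < 2" using assms(1) by (simp add: abs_divide divide_less_eq)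
    then have "pi * \<bar>(x $ i - y $ i) / N\<bar> < pi * 2" by (intro mult_strict_left_mono) auto
    moreover have "pi * (x $ i) / N - pi * (y $ i) / N = pi * ((x $ i - y $ i) / N)"
      by (simp add: right_diff_distrib diff_divide_distrib)
    ultimately have "\<bar>pi * (x $ i) / N - pi * (y $ i) / N\<bar> < 2 * pi"
      by (simp only: abs_mult) simp
    moreover have "cis (pi * (x $ i) / N) = cis (pi * (y $ i) / N)"
      using arg_cong[OF assms(4)[unfolded torus_map_def], of "\<lambda>v. v $ i"] by (simp only: vec_lambda_beta)
    ultimately have "\<i> * complex_of_real (pi * (x $ i) / N) = \<i> * complex_of_real (pi * (y $ i) / N)"
      unfolding cis_conv_exp
      by (intro exp_complex_eqI[where w = "\<i> * complex_of_real (pi * (x $ i) / N)"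
            and z = "\<i> * complex_of_real (pi * (y $ i) / N)"]; simp only: Im_i_times Re_complex_of_real)
    then show ?thesis using assms(1) by simp
  qed
  then show ?thesis by (simp add: vec_eq_iff)
qed

text \<open>The real coordinates on the torus are real and imaginary parts of the first-order
  exponentials, hence trigonometric polynomials. Sums and products stay in
  \<open>trig N\<close>.\<close>

lemma trig_real_polynomial:
  fixes f :: "complex ^ 'd \<Rightarrow> real"
  assumes "N > 0" "real_polynomial_function f"
  shows "(\<lambda>x :: real ^ 'd. complex_of_real (f (torus_map N x))) \<in> trig N"
  using assms(2)
proof induction
  case (linear f)
  interpret bounded_linear f by fact
  \<comment> \<open>Both signs are needed: real and imaginary parts are combinations of an
    exponential and its conjugate. The axis frequency s / (2 N) is a generator of the lattice or its
    negative.\<close>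
  have c: "(\<lambda>x :: real ^ 'd. cis (s * (pi * (x $ i) / N))) \<in> trig N" if "s \<in> {1, -1}" for s i
  proof -
    have "(\<lambda>x :: real ^ 'd. cis (s * (pi * (x $ i) / N))) = echar (axis i (s / (2 * N)))"
      using assms(1) by (auto simp: echar_def inner_axis' fun_eq_iff field_simps)
    moreover have "axis i (s / (2 * N)) \<in> lat N"
      using assms(1) that by (auto simp: lat_def axis_def)
    ultimately show ?thesis using trig.echar by metis
  qed
  have comp: "(\<lambda>x :: real ^ 'd. complex_of_real (torus_map N x \<bullet> b)) \<in> trig N"
    if b0: "b \<in> Basis" for b :: "complex ^ 'd"
  proof -
    obtain i u where b: "b = axis i u" "u \<in> Basis" using b0 unfolding Basis_vec_def by blast
    have "torus_map N x \<bullet> b = cis (pi * (x $ i) / N) \<bullet> u" for x :: "real ^ 'd"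
      by (simp add: b torus_map_def inner_axis)
    moreover have "u = 1 \<or> u = \<i>" using b by (auto simp: Basis_complex_def)
    moreover have "(\<lambda>x :: real ^ 'd. complex_of_real (cis (pi * (x $ i) / N) \<bullet> 1)) \<in> trig N"
    proof -
      have "complex_of_real (cis t \<bullet> 1) = (1/2) * (cis (1 * t) + cis ((-1) * t))" for t
        by (auto simp: complex_eq_iff cis.ctr inner_complex_def)
      then show ?thesis by (simp only:) (intro trig.scale trig.add c, auto)
    qed
    moreover have "(\<lambda>x :: real ^ 'd. complex_of_real (cis (pi * (x $ i) / N) \<bullet> \<i>)) \<in> trig N"
    proof -
      have "complex_of_real (cis t \<bullet> \<i>) = (1 / (2 * \<i>)) * (cis (1 * t) + (-1) * cis ((-1) * t))" for t
        by (auto simp: complex_eq_iff cis.ctr inner_complex_def)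
      then show ?thesis by (simp only:) (intro trig.scale trig.add c, auto)
    qed
    ultimately show ?thesis by auto
  qed
  have "f (torus_map N x) = (\<Sum>b\<in>Basis. (torus_map N x \<bullet> b) * f b)" for x :: "real ^ 'd"
  proof -
    have "f (torus_map N x) = f (\<Sum>b\<in>Basis. (torus_map N x \<bullet> b) *\<^sub>R b)"
      by (simp only: euclidean_representation)
    then show ?thesis by (simp add: sum scaleR)
  qed
  then have "(\<lambda>x :: real ^ 'd. complex_of_real (f (torus_map N x)))
      = (\<lambda>x. \<Sum>b\<in>Basis. complex_of_real (f b) * complex_of_real (torus_map N x \<bullet> b))"
    by (simp add: mult_ac)
  then show ?case using comp by (auto intro!: trig_sum trig.scale)
next
  case (const c)
  then show ?case by (rule trig_const)
next
  case (add f g)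
  then show ?case using trig.add by simp
next
  case (mult f g)
  then show ?case using trig_mult by simp
qed

text \<open>Urysohn and Stone-Weierstrass are applied on the torus, since a continuous function on the cube
  is a uniform limit of trigonometric polynomials only if it is periodic. The map to the torus is
  injective on the open cube, and the rest of the cube is a null set.\<close>

lemma trig_approx_indicator:
  fixes E :: "(real ^ 'd) set"
  assumes N: "N > 0" and E: "E \<in> sets lebesgue" "E \<subseteq> cube N" and "e > 0"
  shows "\<exists>p\<in>trig N. (\<integral>\<^sup>+ x. ennreal ((cmod (indicator E x - p x))\<^sup>2) \<partial>lebesgue_on (cube N)) \<le> ennreal e"
proof -
  let ?Q = "cube N :: (real ^ 'd) set" and ?b = "box (\<chi> i. - N) (\<chi> i. N) :: (real ^ 'd) set"
  let ?M = "lebesgue_on ?Q"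
  define V where "V = (2 * N) ^ CARD('d)"
  have V: "V > 0" "emeasure lebesgue ?Q = ennreal V" 
    using N emeasure_cube[OF N, where 'd='d] by (simp_all only: V_def) simp
  \<comment> \<open>The error splits in two halves. The uniform error contributes at most V
    \<eta>^2, which is at most e / 2. The exceptional set has measure at most 2 d and squared error
    at most 4 there, giving 8 d = e / 2. The bound \<eta> \<le> 1 ensures that value 4.\<close>
  define d where "d = e / 16"
  define \<eta> where "\<eta> = min 1 (sqrt (e / (2 * V)))"
  have d: "d > 0" using \<open>e > 0\<close> by (simp add: d_def)
  have \<eta>: "0 < \<eta>" "\<eta> \<le> 1" "V * \<eta>\<^sup>2 \<le> e / 2"
  proof -
    show "0 < \<eta>" "\<eta> \<le> 1" using V \<open>e > 0\<close> by (auto simp: \<eta>_def)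
    then have "\<eta>\<^sup>2 \<le> (sqrt (e / (2 * V)))\<^sup>2" by (intro power_mono) (auto simp: \<eta>_def)
    then show "V * \<eta>\<^sup>2 \<le> e / 2" using V \<open>e > 0\<close> by (simp add: field_simps)
  qed
  \<comment> \<open>Both inner approximations stay in the open cube: there the torus map is
    injective, so their images are disjoint compact sets that Urysohn can separate.\<close>
  obtain T where T: "closed T" "T \<subseteq> E \<inter> ?b" "emeasure lebesgue (E \<inter> ?b - T) < ennreal d"
    by (rule sets_lebesgue_inner_closed[of "E \<inter> ?b" d]) (use E d in auto)
  obtain U where U: "closed U" "U \<subseteq> ?b - E" "emeasure lebesgue (?b - E - U) < ennreal d"
    by (rule sets_lebesgue_inner_closed[of "?b - E" d]) (use E d in auto)
  have sub: "T \<subseteq> ?b" "U \<subseteq> ?b" using T U by auto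
  then have "compact T" "compact U"
    using T U bounded_subset[OF bounded_box] by (auto simp: compact_eq_bounded_closed)
  then have "closed (torus_map N ` T)" "closed (torus_map N ` U)"
    by (auto intro!: compact_imp_closed compact_continuous_image continuous_torus_map N)
  moreover have "torus_map N ` T \<inter> torus_map N ` U = {}"
    using torus_map_inj[OF N] T(2) U(2) sub by blast
  ultimately obtain G :: "complex ^ 'd \<Rightarrow> real" where G: "continuous_on UNIV G"
    "\<And>z. G z \<in> closed_segment 1 0" "\<And>z. z \<in> torus_map N ` T \<Longrightarrow> G z = 1"
    "\<And>z. z \<in> torus_map N ` U \<Longrightarrow> G z = 0"
    using Urysohn[of "torus_map N ` T" "torus_map N ` U" 1 0] by metis
  have "compact (torus_map N ` ?Q)"
    by (intro compact_continuous_image continuous_torus_map N) (simp add: cube_def)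
  then obtain f where f: "real_polynomial_function f"
    "\<And>z. z \<in> torus_map N ` ?Q \<Longrightarrow> \<bar>G z - f z\<bar> < \<eta>"
    using Stone_Weierstrass_real_polynomial_function[of "torus_map N ` ?Q" G \<eta>]
      continuous_on_subset[OF G(1)] \<eta>(1) by blast
  define p where "p x = complex_of_real (f (torus_map N x))" for x :: "real ^ 'd"
  have p: "p \<in> trig N" unfolding p_def using trig_real_polynomial[OF N f(1)] .
  \<comment> \<open>Outside \<open>R\<close> the Urysohn function agrees with the indicator of
    \<open>E\<close>. The set \<open>R\<close> also absorbs the faces of the cube, which are
    null.\<close>
  define R where "R = ?Q - (T \<union> U)"
  have R: "R \<in> sets lebesgue" unfolding R_def using T U by (auto intro!: sets.Diff lebesgue_closedin)
  have eR: "emeasure lebesgue R \<le> ennreal (2 * d)"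
  proof -
    have sets: "E \<inter> ?b - T \<in> sets lebesgue" "?b - E - U \<in> sets lebesgue" "?Q - ?b \<in> sets lebesgue"
      using E T U by (auto intro!: sets.Diff)
    have z: "emeasure lebesgue (?Q - ?b) = 0"
      using negligible_frontier_interval[of "(\<chi> i. - N) :: real ^ 'd" "\<chi> i. N"]
      by (simp add: negligible_iff_null_sets cube_def null_setsD1)
    have "R \<subseteq> (E \<inter> ?b - T) \<union> (?b - E - U) \<union> (?Q - ?b)" by (auto simp: R_def)
    then have "emeasure lebesgue R \<le> emeasure lebesgue ((E \<inter> ?b - T) \<union> (?b - E - U) \<union> (?Q - ?b))"
      using sets by (intro emeasure_mono) auto
    also have "\<dots> \<le> emeasure lebesgue (E \<inter> ?b - T) + emeasure lebesgue (?b - E - U) + emeasure lebesgue (?Q - ?b)"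
      using sets by (meson add_mono emeasure_subadditive order_refl order_trans sets.Un)
    also have "\<dots> \<le> ennreal d + ennreal d + 0" unfolding z using T U by (intro add_mono) auto
    also have "\<dots> = ennreal (2 * d)" using d by (simp flip: ennreal_plus)
    finally show ?thesis .
  qed
  have bound: "(cmod (indicator E x - p x))\<^sup>2 \<le> \<eta>\<^sup>2 + 4 * indicator R x" if x: "x \<in> ?Q" for x
  proof -
    have c: "cmod (indicator E x - p x) = \<bar>indicat_real E x - f (torus_map N x)\<bar>"
    proof -
      have "indicator E x - p x = complex_of_real (indicat_real E x - f (torus_map N x))"
        by (simp add: p_def indicator_def)
      then show ?thesis by (simp only: norm_of_real)
    qed
    have a: "\<bar>G (torus_map N x) - f (torus_map N x)\<bar> < \<eta>" using f(2) x by blast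
    show ?thesis
    proof (cases "x \<in> R")
      case True
      have "0 \<le> G (torus_map N x)" "G (torus_map N x) \<le> 1" 
        using G(2)[of "torus_map N x"] by (auto simp: closed_segment_eq_real_ivl)
      moreover have "0 \<le> indicat_real E x" "indicat_real E x \<le> 1" by (auto simp: indicator_def)
      ultimately have "\<bar>indicat_real E x - f (torus_map N x)\<bar> \<le> 2" using a \<eta> by linarith
      then have "\<bar>indicat_real E x - f (torus_map N x)\<bar>\<^sup>2 \<le> 2\<^sup>2" by (intro power_mono) auto
      then have "\<bar>indicat_real E x - f (torus_map N x)\<bar>\<^sup>2 \<le> 0 + 4" by simp
      also have "\<dots> \<le> \<eta>\<^sup>2 + 4" by (intro add_right_mono) simp
      finally show ?thesis using True unfolding c by simp
    next
      case False
      then have "x \<in> T \<or> x \<in> U" using x by (auto simp: R_def)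
      then have "G (torus_map N x) = indicat_real E x" using G(3,4) T U by (auto simp: indicator_def)
      then have "\<bar>indicat_real E x - f (torus_map N x)\<bar> \<le> \<eta>" using a by simp
      then have "\<bar>indicat_real E x - f (torus_map N x)\<bar>\<^sup>2 \<le> \<eta>\<^sup>2" by (intro power_mono) auto
      then show ?thesis using False unfolding c by simp
    qed
  qed
  have "(\<integral>\<^sup>+ x. ennreal ((cmod (indicator E x - p x))\<^sup>2) \<partial>?M)
      \<le> (\<integral>\<^sup>+ x. ennreal (\<eta>\<^sup>2) + 4 * indicator R x \<partial>?M)"
  proof (rule nn_integral_mono)
    fix x assume "x \<in> space ?M"
    then have "ennreal ((cmod (indicator E x - p x))\<^sup>2) \<le> ennreal (\<eta>\<^sup>2 + 4 * indicator R x)"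
      using bound by (intro ennreal_leI) auto
    also have "\<dots> = ennreal (\<eta>\<^sup>2) + 4 * indicator R x"
      by (auto simp: indicator_def ennreal_plus)
    finally show "ennreal ((cmod (indicator E x - p x))\<^sup>2) \<le> ennreal (\<eta>\<^sup>2) + 4 * indicator R x" .
  qed
  also have "\<dots> = ennreal (\<eta>\<^sup>2) * emeasure ?M ?Q + 4 * emeasure ?M R"
  proof -
    have [measurable]: "R \<in> sets ?M" using R by (auto simp: sets_restrict_space R_def intro!: image_eqI[of _ _ R])
    show ?thesis by (subst nn_integral_add) (auto simp: nn_integral_cmult_indicator space_restrict_space)
  qed
  also have "emeasure ?M ?Q = ennreal V" using V by (simp add: emeasure_restrict_space)
  also have "emeasure ?M R = emeasure lebesgue R" by (auto simp: emeasure_restrict_space R_def)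
  also have "ennreal (\<eta>\<^sup>2) * ennreal V + 4 * emeasure lebesgue R \<le> ennreal (\<eta>\<^sup>2) * ennreal V + 4 * ennreal (2 * d)"
    using eR by (intro add_left_mono mult_left_mono) auto
  also have "\<dots> = ennreal (\<eta>\<^sup>2 * V + 4 * (2 * d))"
    using V d by (simp add: ennreal_plus ennreal_mult)
  also have "\<dots> \<le> ennreal e" using \<eta> by (intro ennreal_leI) (auto simp: d_def mult.commute)
  finally show ?thesis using p by blast
qed

section \<open>Density of trigonometric polynomials in L2 of the cube\<close>

text \<open>A triangle inequality for squared distances with a factor 2 is enough for density and
  replaces Minkowski. It is the origin of the tolerances e / 4 below.\<close>

lemma nn_integral_cmod_add_power2_le:
  assumes [measurable]: "f \<in> borel_measurable M" "g \<in> borel_measurable M"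
  shows "(\<integral>\<^sup>+ x. ennreal ((cmod (f x + g x))\<^sup>2) \<partial>M)
    \<le> 2 * (\<integral>\<^sup>+ x. ennreal ((cmod (f x))\<^sup>2) \<partial>M) + 2 * (\<integral>\<^sup>+ x. ennreal ((cmod (g x))\<^sup>2) \<partial>M)"
proof -
  have "(\<integral>\<^sup>+ x. ennreal ((cmod (f x + g x))\<^sup>2) \<partial>M)
      \<le> (\<integral>\<^sup>+ x. 2 * ennreal ((cmod (f x))\<^sup>2) + 2 * ennreal ((cmod (g x))\<^sup>2) \<partial>M)"
    using cmod_add_power2_le[of "f _" "g _"] by (intro nn_integral_mono) (simp flip: ennreal_plus ennreal_numeral add: ennreal_mult[symmetric])
  then show ?thesis by (simp add: nn_integral_add nn_integral_cmult)
qed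

text \<open>Membership in the closure of the trigonometric polynomials. The nonnegative integral
  gives the distance a meaning before the difference is known to be square-integrable.\<close>

definition approximable :: "real \<Rightarrow> (real ^ 'd \<Rightarrow> complex) \<Rightarrow> bool" where
  "approximable N h \<longleftrightarrow> h \<in> borel_measurable (lebesgue_on (cube N)) \<and>
    (\<forall>e>0. \<exists>p\<in>trig N. (\<integral>\<^sup>+ x. ennreal ((cmod (h x - p x))\<^sup>2) \<partial>lebesgue_on (cube N)) \<le> ennreal e)"

lemma trig_measurable: "p \<in> trig N \<Longrightarrow> p \<in> borel_measurable (lebesgue_on (cube N))"
  using trig_L2[OF finite_measure_cube, THEN L2_measurable] .

lemma approximable_trig: "p \<in> trig N \<Longrightarrow> approximable N p"
  unfolding approximable_def using trig_measurable by (auto intro!: bexI[of _ p])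

lemma approximable_add:
  assumes "approximable N f" "approximable N g"
  shows "approximable N (\<lambda>x. f x + g x)"
  unfolding approximable_def
proof (intro conjI allI impI)
  note [measurable] = assms[unfolded approximable_def, THEN conjunct1]
  show "(\<lambda>x. f x + g x) \<in> borel_measurable (lebesgue_on (cube N))" by measurable
  fix e :: real assume "e > 0"
  then have "e / 4 > 0" by simp
  then obtain p q where p: "p \<in> trig N" "(\<integral>\<^sup>+ x. ennreal ((cmod (f x - p x))\<^sup>2) \<partial>lebesgue_on (cube N)) \<le> ennreal (e / 4)"
    and q: "q \<in> trig N" "(\<integral>\<^sup>+ x. ennreal ((cmod (g x - q x))\<^sup>2) \<partial>lebesgue_on (cube N)) \<le> ennreal (e / 4)"
    using assms unfolding approximable_def by meson
  note [measurable] = trig_measurable[OF p(1)] trig_measurable[OF q(1)]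
  have "(\<integral>\<^sup>+ x. ennreal ((cmod ((f x - p x) + (g x - q x)))\<^sup>2) \<partial>lebesgue_on (cube N))
      \<le> 2 * (\<integral>\<^sup>+ x. ennreal ((cmod (f x - p x))\<^sup>2) \<partial>lebesgue_on (cube N))
        + 2 * (\<integral>\<^sup>+ x. ennreal ((cmod (g x - q x))\<^sup>2) \<partial>lebesgue_on (cube N))"
    by (intro nn_integral_cmod_add_power2_le) measurable
  also have "\<dots> \<le> 2 * ennreal (e / 4) + 2 * ennreal (e / 4)"
    using p q by (intro add_mono mult_left_mono) auto
  also have "\<dots> = ennreal e"
    using \<open>e > 0\<close> by (simp flip: ennreal_plus ennreal_numeral ennreal_mult)
  finally show "\<exists>r\<in>trig N. (\<integral>\<^sup>+ x. ennreal ((cmod (f x + g x - r x))\<^sup>2) \<partial>lebesgue_on (cube N)) \<le> ennreal e"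
    using trig.add[OF p(1) q(1)] by (intro bexI[of _ "\<lambda>x. p x + q x"]) (simp_all add: algebra_simps)
qed

lemma approximable_scale:
  assumes "approximable N f"
  shows "approximable N (\<lambda>x. c * f x)"
  unfolding approximable_def
proof (intro conjI allI impI)
  note [measurable] = assms[unfolded approximable_def, THEN conjunct1]
  show "(\<lambda>x. c * f x) \<in> borel_measurable (lebesgue_on (cube N))" by measurable
  fix e :: real assume "e > 0"
  \<comment> \<open>The added 1 keeps the tolerance well defined for c = 0.\<close>
  then have "e / ((cmod c)\<^sup>2 + 1) > 0" by (simp add: add_nonneg_pos)
  then obtain p where p: "p \<in> trig N"
    "(\<integral>\<^sup>+ x. ennreal ((cmod (f x - p x))\<^sup>2) \<partial>lebesgue_on (cube N)) \<le> ennreal (e / ((cmod c)\<^sup>2 + 1))"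
    using assms unfolding approximable_def by meson
  note [measurable] = trig_measurable[OF p(1)]
  have "(\<integral>\<^sup>+ x. ennreal ((cmod (c * f x - c * p x))\<^sup>2) \<partial>lebesgue_on (cube N))
      = (\<integral>\<^sup>+ x. ennreal ((cmod c)\<^sup>2) * ennreal ((cmod (f x - p x))\<^sup>2) \<partial>lebesgue_on (cube N))"
    by (intro nn_integral_cong) 
      (simp add: ennreal_mult[symmetric] power_mult_distrib norm_mult flip: right_diff_distrib)
  also have "\<dots> = ennreal ((cmod c)\<^sup>2) * (\<integral>\<^sup>+ x. ennreal ((cmod (f x - p x))\<^sup>2) \<partial>lebesgue_on (cube N))"
    by (rule nn_integral_cmult) measurable
  also have "\<dots> \<le> ennreal ((cmod c)\<^sup>2) * ennreal (e / ((cmod c)\<^sup>2 + 1))"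
    using p by (intro mult_left_mono) auto
  also have "\<dots> = ennreal ((cmod c)\<^sup>2 * (e / ((cmod c)\<^sup>2 + 1)))"
    using \<open>e > 0\<close> by (intro ennreal_mult[symmetric]) auto
  also have "\<dots> \<le> ennreal e"
  proof (rule ennreal_leI)
    have "0 < (cmod c)\<^sup>2 + 1" by (simp add: add_nonneg_pos)
    then show "(cmod c)\<^sup>2 * (e / ((cmod c)\<^sup>2 + 1)) \<le> e" using \<open>e > 0\<close> by (simp add: pos_divide_le_eq algebra_simps)
  qed
  finally show "\<exists>r\<in>trig N. (\<integral>\<^sup>+ x. ennreal ((cmod (c * f x - r x))\<^sup>2) \<partial>lebesgue_on (cube N)) \<le> ennreal e"
    using trig.scale[OF p(1)] by (intro bexI[of _ "\<lambda>x. c * p x"])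
qed

lemma approximable_limit:
  assumes [measurable]: "h \<in> borel_measurable (lebesgue_on (cube N))"
    and "\<And>e. e > 0 \<Longrightarrow> \<exists>f. approximable N f \<and>
      (\<integral>\<^sup>+ x. ennreal ((cmod (h x - f x))\<^sup>2) \<partial>lebesgue_on (cube N)) \<le> ennreal e"
  shows "approximable N h"
  unfolding approximable_def
proof (intro conjI allI impI)
  fix e :: real assume "e > 0"
  then have "e / 4 > 0" by simp
  then obtain f where f: "approximable N f"
    "(\<integral>\<^sup>+ x. ennreal ((cmod (h x - f x))\<^sup>2) \<partial>lebesgue_on (cube N)) \<le> ennreal (e / 4)"
    using assms(2) by meson
  note [measurable] = f(1)[unfolded approximable_def, THEN conjunct1]
  obtain p where p: "p \<in> trig N"
    "(\<integral>\<^sup>+ x. ennreal ((cmod (f x - p x))\<^sup>2) \<partial>lebesgue_on (cube N)) \<le> ennreal (e / 4)"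
    using f(1) \<open>e / 4 > 0\<close> unfolding approximable_def by meson
  note [measurable] = trig_measurable[OF p(1)]
  have "(\<integral>\<^sup>+ x. ennreal ((cmod ((h x - f x) + (f x - p x)))\<^sup>2) \<partial>lebesgue_on (cube N))
      \<le> 2 * (\<integral>\<^sup>+ x. ennreal ((cmod (h x - f x))\<^sup>2) \<partial>lebesgue_on (cube N))
        + 2 * (\<integral>\<^sup>+ x. ennreal ((cmod (f x - p x))\<^sup>2) \<partial>lebesgue_on (cube N))"
    by (intro nn_integral_cmod_add_power2_le) measurable
  also have "\<dots> \<le> 2 * ennreal (e / 4) + 2 * ennreal (e / 4)"
    using p f by (intro add_mono mult_left_mono) auto
  also have "\<dots> = ennreal e"
    using \<open>e > 0\<close> by (simp flip: ennreal_plus ennreal_numeral ennreal_mult)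
  finally show "\<exists>r\<in>trig N. (\<integral>\<^sup>+ x. ennreal ((cmod (h x - r x))\<^sup>2) \<partial>lebesgue_on (cube N)) \<le> ennreal e"
    using p(1) by (intro bexI[of _ p]) simp_all
qed fact

text \<open>Indicators generate simple functions linearly, and dominated convergence passes from
  simple functions to \<open>h\<close>.\<close>

lemma L2_approximable:
  fixes h :: "real ^ 'd \<Rightarrow> complex"
  assumes N: "N > 0" and h: "h \<in> L2 (cube N)"
  shows "approximable N h"
proof (rule approximable_limit)
  let ?M = "lebesgue_on (cube N :: (real ^ 'd) set)"
  note [measurable] = L2_measurable[OF h]
  show "h \<in> borel_measurable ?M" by measurable
  have ind: "approximable N (indicator E)" if "E \<in> sets ?M" for E :: "(real ^ 'd) set"
    unfolding approximable_def
  proof (intro conjI allI impI)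
    show "indicator E \<in> borel_measurable ?M" using that by measurable
    have "E \<in> sets lebesgue" "E \<subseteq> cube N"
      using that by (auto simp: sets_restrict_space)
    then show "\<exists>p\<in>trig N. (\<integral>\<^sup>+ x. ennreal ((cmod (indicator E x - p x))\<^sup>2) \<partial>?M) \<le> ennreal e"
      if "e > 0" for e
      using trig_approx_indicator[OF N] that by blast
  qed
  obtain s where s: "\<And>i. simple_function ?M (s i)"
    "\<And>x. x \<in> cube N \<Longrightarrow> (\<lambda>i. s i x) \<longlonglongrightarrow> h x"
    "\<And>i x. x \<in> cube N \<Longrightarrow> dist (s i x) 0 \<le> 2 * dist (h x) 0"
  proof -
    show thesis if "\<And>s. (\<And>i. simple_function ?M (s i)) \<Longrightarrow> (\<And>x. x \<in> cube N \<Longrightarrow> (\<lambda>i. s i x) \<longlonglongrightarrow> h x) \<Longrightarrow>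
        (\<And>i x. x \<in> cube N \<Longrightarrow> dist (s i x) 0 \<le> 2 * dist (h x) 0) \<Longrightarrow> thesis"
      using borel_measurable_implies_sequence_metric[of h ?M 0] L2_measurable[OF h] that
      unfolding space_lebesgue_on by blast
  qed
  have s_app: "approximable N (s i)" for i
  proof -
    have sets: "s i -` {y} \<inter> cube N \<in> sets ?M" for y
      using simple_functionD(2)[OF s(1), of i "{y}"] by (simp add: space_restrict_space)
    have fin: "finite (s i ` cube N)"
      using simple_functionD(1)[OF s(1), of i] by (simp add: space_restrict_space)
    have sum: "approximable N (\<lambda>x. \<Sum>y\<in>Y. y * indicator (s i -` {y} \<inter> cube N) x)" for Y
    proof (induction Y rule: infinite_finite_induct)
      case (insert y Y)
      show ?case
        unfolding sum.insert[OF insert.hyps]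
        by (intro approximable_add approximable_scale ind sets insert.IH)
    qed (simp_all add: approximable_trig trig_const)
    have eq: "s i x = (\<Sum>y\<in>s i ` cube N. y * indicator (s i -` {y} \<inter> cube N) x)" if "x \<in> cube N" for x
      using that fin by (simp add: indicator_def of_bool_def if_distrib sum.delta cong: if_cong)
    show ?thesis
      using sum[of "s i ` cube N"] borel_measurable_simple_function[OF s(1), of i]
      unfolding approximable_def by (simp add: eq[symmetric] cong: nn_integral_cong_simp)
  qed
  note [measurable] = borel_measurable_simple_function[OF s(1)]
  have "(\<lambda>i. \<integral>\<^sup>+ x. ennreal ((cmod (h x - s i x))\<^sup>2) \<partial>?M) \<longlonglongrightarrow> (\<integral>\<^sup>+ x. 0 \<partial>?M)"
  proof (rule nn_integral_dominated_convergence)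
    show "(\<integral>\<^sup>+ x. ennreal (9 * (cmod (h x))\<^sup>2) \<partial>?M) < \<infinity>"
      using L2_integrable[OF h] by (subst nn_integral_eq_integral) auto
    \<comment> \<open>The simple functions are bounded by 2 |h|, so the difference is at most 3 |h|;
      this explains the 9 in the dominating function.\<close>
    have "(cmod (h x - s j x))\<^sup>2 \<le> 9 * (cmod (h x))\<^sup>2" if "x \<in> cube N" for x j
    proof -
      have "cmod (h x - s j x) \<le> cmod (h x) + cmod (s j x)" by (rule norm_triangle_ineq4)
      also have "\<dots> \<le> 3 * cmod (h x)" using s(3)[OF that, of j] by simp
      finally have "(cmod (h x - s j x))\<^sup>2 \<le> (3 * cmod (h x))\<^sup>2" by (intro power_mono) auto
      then show ?thesis by (simp add: power_mult_distrib)
    qed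
    then show "AE x in ?M. ennreal ((cmod (h x - s j x))\<^sup>2) \<le> ennreal (9 * (cmod (h x))\<^sup>2)" for j
      by (intro AE_I2 ennreal_leI) (simp add: space_restrict_space)
    have "(\<lambda>i. ennreal ((cmod (h x - s i x))\<^sup>2)) \<longlonglongrightarrow> ennreal 0" if "x \<in> cube N" for x
    proof (rule tendsto_ennrealI)
      have "(\<lambda>i. (cmod (h x - s i x))\<^sup>2) \<longlonglongrightarrow> (cmod (h x - h x))\<^sup>2"
        by (intro tendsto_intros s(2) that)
      then show "(\<lambda>i. (cmod (h x - s i x))\<^sup>2) \<longlonglongrightarrow> 0" by simp
    qed
    then show "AE x in ?M. (\<lambda>i. ennreal ((cmod (h x - s i x))\<^sup>2)) \<longlonglongrightarrow> 0"
      by (intro AE_I2) (simp add: space_restrict_space)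
  qed measurable
  then have lim: "(\<lambda>i. \<integral>\<^sup>+ x. ennreal ((cmod (h x - s i x))\<^sup>2) \<partial>?M) \<longlonglongrightarrow> 0" by simp
  fix e :: real assume "e > 0"
  then have "eventually (\<lambda>i. (\<integral>\<^sup>+ x. ennreal ((cmod (h x - s i x))\<^sup>2) \<partial>?M) < ennreal e) sequentially"
    by (intro order_tendstoD(2)[OF lim]) simp
  then obtain i where "(\<integral>\<^sup>+ x. ennreal ((cmod (h x - s i x))\<^sup>2) \<partial>?M) < ennreal e"
    by (auto dest: eventually_happens)
  then show "\<exists>f. approximable N f \<and> (\<integral>\<^sup>+ x. ennreal ((cmod (h x - f x))\<^sup>2) \<partial>?M) \<le> ennreal e"
    using s_app by (intro exI[of _ "s i"]) (simp add: less_imp_le)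
qed

section \<open>Parseval on the cube and on its measurable subsets\<close>

text \<open>Both inequalities come from the completed square. With a k = ft / V its last sum
  vanishes, and nonnegativity of the distance is Bessel. For the other direction a trigonometric
  polynomial at squared distance at most e / V is inserted and the last sum is discarded.\<close>

lemma parseval_cube:
  fixes h :: "real ^ 'd \<Rightarrow> complex"
  assumes N: "N > 0" and h: "h \<in> L2 (cube N)"
  shows "(\<Sum>\<^sub>\<infinity>k\<in>lat N. ennreal ((cmod (ft (cube N) h k))\<^sup>2))
    = ennreal ((2 * N) ^ CARD('d) * (L2_norm (cube N) h)\<^sup>2)"
proof (rule antisym)
  let ?M = "lebesgue_on (cube N :: (real ^ 'd) set)"
  define V where "V = (2 * N) ^ CARD('d)"
  have V: "V > 0" using N by (simp add: V_def)
  show "(\<Sum>\<^sub>\<infinity>k\<in>lat N. ennreal ((cmod (ft (cube N) h k))\<^sup>2)) \<le> ennreal ((2 * N) ^ CARD('d) * (L2_norm (cube N) h)\<^sup>2)"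
  proof (rule infsum_le_finite_sums)
    fix F :: "(real ^ 'd) set" assume F: "finite F" "F \<subseteq> lat N"
    have z: "V * (ft (cube N) h k / V) = ft (cube N) h k" for k using V by simp
    have "0 \<le> V * (LINT x|?M. (cmod (h x - (\<Sum>k\<in>F. ft (cube N) h k / V * echar k x)))\<^sup>2)"
      using V by simp
    also have "\<dots> = V * (L2_norm (cube N) h)\<^sup>2 - (\<Sum>k\<in>F. (cmod (ft (cube N) h k))\<^sup>2)"
      using L2_dist_trig_sum[OF N h F, of "\<lambda>k. ft (cube N) h k / V", folded V_def] by (simp only: z) simp
    finally show "(\<Sum>k\<in>F. ennreal ((cmod (ft (cube N) h k))\<^sup>2)) \<le> ennreal ((2 * N) ^ CARD('d) * (L2_norm (cube N) h)\<^sup>2)"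
      by (subst sum_ennreal) (auto intro!: ennreal_leI simp: V_def)
  qed (rule nonneg_summable_on_complete, simp)
  show "ennreal ((2 * N) ^ CARD('d) * (L2_norm (cube N) h)\<^sup>2) \<le> (\<Sum>\<^sub>\<infinity>k\<in>lat N. ennreal ((cmod (ft (cube N) h k))\<^sup>2))"
  proof (rule ennreal_le_epsilon)
    fix e :: real assume "e > 0"
    then have "e / V > 0" using V by simp
    then obtain p where p: "p \<in> trig N" "(\<integral>\<^sup>+ x. ennreal ((cmod (h x - p x))\<^sup>2) \<partial>?M) \<le> ennreal (e / V)"
      using L2_approximable[OF N h] unfolding approximable_def by meson
    obtain F a where F: "finite F" "F \<subseteq> lat N" and pF: "p = (\<lambda>x. \<Sum>k\<in>F. a k * echar k x)"
      using trig_eq_sum[OF p(1)] by (elim exE conjE)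
    have "(\<lambda>x. h x + (- 1) * p x) \<in> L2 (cube N)"
      by (rule L2_add[OF h trig_L2[OF finite_measure_cube trig.scale[OF p(1)]]])
    then have "integrable ?M (\<lambda>x. (cmod (h x - p x))\<^sup>2)" by (simp add: L2_def)
    then have "(\<integral>\<^sup>+ x. ennreal ((cmod (h x - p x))\<^sup>2) \<partial>?M) = ennreal (LINT x|?M. (cmod (h x - p x))\<^sup>2)"
      by (intro nn_integral_eq_integral) auto
    then have "(LINT x|?M. (cmod (h x - p x))\<^sup>2) \<le> e / V"
      using p(2) \<open>e / V > 0\<close> by (simp add: ennreal_le_iff)
    then have "V * (LINT x|?M. (cmod (h x - p x))\<^sup>2) \<le> e"
      using V by (simp add: field_simps)
    moreover have "V * (L2_norm (cube N) h)\<^sup>2 - (\<Sum>k\<in>F. (cmod (ft (cube N) h k))\<^sup>2)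
        \<le> V * (LINT x|?M. (cmod (h x - p x))\<^sup>2)"
      unfolding pF V_def L2_dist_trig_sum[OF N h F] by (simp add: sum_nonneg)
    ultimately have "V * (L2_norm (cube N) h)\<^sup>2 \<le> (\<Sum>k\<in>F. (cmod (ft (cube N) h k))\<^sup>2) + e" by linarith
    then have "ennreal (V * (L2_norm (cube N) h)\<^sup>2) \<le> ennreal ((\<Sum>k\<in>F. (cmod (ft (cube N) h k))\<^sup>2) + e)"
      by (rule ennreal_leI)
    also have "\<dots> = (\<Sum>k\<in>F. ennreal ((cmod (ft (cube N) h k))\<^sup>2)) + ennreal e"
      using \<open>e > 0\<close> by (simp add: ennreal_plus sum_nonneg sum_ennreal)
    also have "\<dots> \<le> (\<Sum>\<^sub>\<infinity>k\<in>lat N. ennreal ((cmod (ft (cube N) h k))\<^sup>2)) + ennreal e"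
    proof (rule add_right_mono)
      have "(\<Sum>k\<in>F. ennreal ((cmod (ft (cube N) h k))\<^sup>2)) = infsum (\<lambda>k. ennreal ((cmod (ft (cube N) h k))\<^sup>2)) F"
        using F by simp
      also have "\<dots> \<le> (\<Sum>\<^sub>\<infinity>k\<in>lat N. ennreal ((cmod (ft (cube N) h k))\<^sup>2))"
        using F by (intro infsum_mono_neutral nonneg_summable_on_complete) auto
      finally show "(\<Sum>k\<in>F. ennreal ((cmod (ft (cube N) h k))\<^sup>2)) \<le> (\<Sum>\<^sub>\<infinity>k\<in>lat N. ennreal ((cmod (ft (cube N) h k))\<^sup>2))" .
    qed
    finally show "ennreal ((2 * N) ^ CARD('d) * (L2_norm (cube N) h)\<^sup>2)
        \<le> (\<Sum>\<^sub>\<infinity>k\<in>lat N. ennreal ((cmod (ft (cube N) h k))\<^sup>2)) + ennreal e"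
      by (simp add: V_def)
  qed
qed

lemma L2_extend:
  assumes "\<Omega> \<subseteq> S" "\<Omega> \<in> sets lebesgue" "S \<in> sets lebesgue" "h \<in> L2 \<Omega>"
  shows "(\<lambda>x. if x \<in> \<Omega> then h x else 0) \<in> L2 S"
proof -
  let ?h = "\<lambda>x. if x \<in> \<Omega> then h x else 0"
  have ind: "indicator S x *\<^sub>R (if x \<in> \<Omega> then h x else 0) = indicator \<Omega> x *\<^sub>R h x"
    "indicator S x *\<^sub>R (if x \<in> \<Omega> then (cmod (h x))\<^sup>2 else 0) = indicator \<Omega> x *\<^sub>R (cmod (h x))\<^sup>2" for x
    using assms(1) by (auto simp: indicator_def)
  have "?h \<in> borel_measurable (lebesgue_on S)"
    using L2_measurable[OF assms(4)] assms(2,3)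
    by (simp add: borel_measurable_restrict_space_iff ind)
  moreover have "integrable (lebesgue_on S) (\<lambda>x. (if x \<in> \<Omega> then (cmod (h x))\<^sup>2 else 0))"
    using L2_integrable[OF assms(4)] assms(2,3)
    by (simp add: integrable_restrict_space ind(2) del: real_scaleR_def)
  moreover have "(cmod (?h x))\<^sup>2 = (if x \<in> \<Omega> then (cmod (h x))\<^sup>2 else 0)" for x by simp
  ultimately show ?thesis by (simp add: L2_def)
qed

text \<open>Extension by zero changes neither the coefficients nor the norm. The characters of the
  lattice, restricted to \<Omega>, thus form a tight frame, although they need not stay
  orthogonal.\<close>

lemma parseval:
  fixes h :: "real ^ 'd \<Rightarrow> complex"
  assumes N: "N > 0" and \<Omega>: "\<Omega> \<in> sets lebesgue" "\<Omega> \<subseteq> cube N" and h: "h \<in> L2 \<Omega>"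
  shows "(\<Sum>\<^sub>\<infinity>k\<in>lat N. ennreal ((cmod (ft \<Omega> h k))\<^sup>2)) = ennreal ((2 * N) ^ CARD('d) * (L2_norm \<Omega> h)\<^sup>2)"
proof -
  define h' where "h' x = (if x \<in> \<Omega> then h x else 0)" for x
  have "h' \<in> L2 (cube N)" unfolding h'_def by (rule L2_extend) (use \<Omega> h in auto)
  moreover have "ft (cube N) h' k = ft \<Omega> h k" for k
  proof -
    have "h' x * cnj (echar k x) = (if x \<in> \<Omega> then h x * cnj (echar k x) else 0)" for x
      by (simp add: h'_def)
    then show ?thesis unfolding ft_def using \<Omega> by (simp add: integral_restrict)
  qed
  moreover have "(L2_norm (cube N) h')\<^sup>2 = (L2_norm \<Omega> h)\<^sup>2"
  proof -
    have "(cmod (h' x))\<^sup>2 = (if x \<in> \<Omega> then (cmod (h x))\<^sup>2 else 0)" for x by (simp add: h'_def)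
    then show ?thesis unfolding L2_norm_power2 using \<Omega> by (simp add: integral_restrict)
  qed
  ultimately show ?thesis using parseval_cube[OF N, of h'] by simp
qed

section \<open>Plancherel on bounded sets\<close>

text \<open>Joint measurability in frequency and position passes to the parameter integral. This
  makes the integrals over frequencies below legitimate.\<close>

lemma ft_measurable:
  fixes h :: "real ^ 'd \<Rightarrow> complex"
  assumes "finite_measure (lebesgue_on \<Omega>)" and [measurable]: "h \<in> borel_measurable (lebesgue_on \<Omega>)"
  shows "ft \<Omega> h \<in> borel_measurable borel"
proof -
  interpret finite_measure "lebesgue_on \<Omega>" by fact
  have [measurable]: "(\<lambda>x. x) \<in> lebesgue_on \<Omega> \<rightarrow>\<^sub>M borel"
    by (intro measurable_restrict_space1 measurable_completion) simp
  have "(\<lambda>z. case_prod echar (fst z, snd z)) \<in> borel_measurable (borel \<Otimes>\<^sub>M lebesgue_on \<Omega>)"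
    by measurable
  then have [measurable]: "(\<lambda>(\<eta>, x). echar \<eta> x) \<in> borel_measurable (borel \<Otimes>\<^sub>M lebesgue_on \<Omega>)"
    by (simp add: case_prod_beta)
  have "(\<lambda>(\<eta>, x). h x * cnj (echar \<eta> x)) \<in> borel_measurable (borel \<Otimes>\<^sub>M lebesgue_on \<Omega>)"
    by measurable
  then show ?thesis unfolding ft_def[abs_def] by (rule borel_measurable_lebesgue_integral)
qed

text \<open>Translating the frequencies amounts to modulating the function, which preserves its
  norm. Any frame inequality therefore holds for all translates of the frequency sets with the same
  constants.\<close>

lemma ft_add: "ft \<Omega> h (k + t) = ft \<Omega> (\<lambda>x. h x * cnj (echar t x)) k"
  unfolding ft_def echar_add by (simp add: mult_ac)

lemma L2_modulate: "h \<in> L2 \<Omega> \<Longrightarrow> (\<lambda>x. h x * cnj (echar t x)) \<in> L2 \<Omega>"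
  by (rule L2_bounded_mult[where C = 1]) auto

lemma L2_norm_modulate: "L2_norm \<Omega> (\<lambda>x. h x * cnj (echar t x)) = L2_norm \<Omega> h"
  by (simp add: L2_norm_def norm_mult)

lemma nn_integral_lborel_translate:
  fixes f :: "'a::euclidean_space \<Rightarrow> ennreal"
  assumes [measurable]: "f \<in> borel_measurable borel"
  shows "(\<integral>\<^sup>+ x. f (c + x) \<partial>lborel) = (\<integral>\<^sup>+ x. f x \<partial>lborel)"
proof -
  have "(\<integral>\<^sup>+ x. f x \<partial>lborel) = (\<integral>\<^sup>+ x. f x \<partial>distr lborel borel ((+) c))"
    by (simp add: lborel_distr_plus)
  also have "\<dots> = (\<integral>\<^sup>+ x. f (c + x) \<partial>lborel)"
    by (rule nn_integral_distr) simp_all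
  finally show ?thesis by simp
qed

lemma bounded_subset_cube:
  fixes \<Omega> :: "(real ^ 'd) set"
  assumes "bounded \<Omega>"
  obtains N where "N > 0" "\<Omega> \<subseteq> cube N"
proof -
  obtain N where N: "N > 0" "\<And>x. x \<in> \<Omega> \<Longrightarrow> norm x \<le> N"
    using assms by (auto simp: bounded_pos)
  have "x \<in> cube N" if "x \<in> \<Omega>" for x
  proof -
    have "\<bar>x $ i\<bar> \<le> N" for i using component_le_norm_cart[of x i] N(2)[OF that] by linarith
    then show ?thesis by (auto simp: cube_def mem_box_cart abs_le_iff minus_le_iff)
  qed
  then show ?thesis using that N(1) by blast
qed

text \<open>\<open>cell N\<close> is a fundamental domain of \<open>lat N\<close>.\<close>

definition cell :: "real \<Rightarrow> (real ^ 'd) set" where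
  "cell N = {x. \<forall>i. 0 \<le> x $ i \<and> x $ i < 1 / (2 * N)}"

lemma vec_nth_measurable [measurable]: "(\<lambda>x :: real ^ 'd. x $ i) \<in> borel_measurable borel"
  by (intro borel_measurable_continuous_onI continuous_intros)

lemma cell_sets [measurable]: "cell N \<in> sets borel"
proof -
  have "cell N = (\<Inter>i. {x \<in> space borel. 0 \<le> x $ i \<and> x $ i < 1 / (2 * N)})"
    by (auto simp: cell_def)
  also have "\<dots> \<in> sets borel" by (rule sets.finite_INT) (simp, simp, measurable)
  finally show ?thesis .
qed

lemma emeasure_cell:
  assumes "N > 0"
  shows "emeasure lborel (cell N :: (real ^ 'd) set) = ennreal (1 / (2 * N) ^ CARD('d))"
proof -
  let ?u = "(\<chi> i. 1 / (2 * N)) :: real ^ 'd"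
  have e: "emeasure lborel (cbox 0 ?u) = ennreal (1 / (2 * N) ^ CARD('d))"
    "emeasure lborel (box 0 ?u) = ennreal (1 / (2 * N) ^ CARD('d))"
    using assms by (auto simp: emeasure_lborel_cbox_eq emeasure_lborel_box_eq inner_axis Basis_vec_def
      prod.UNION_disjoint axis_eq_axis power_divide)
  have "box 0 ?u \<subseteq> cell N" "cell N \<subseteq> cbox 0 ?u"
    by (auto simp: cell_def mem_box_cart less_imp_le)
  then show ?thesis
    using emeasure_mono[of "box 0 ?u" "cell N" lborel] emeasure_mono[of "cell N" "cbox 0 ?u" lborel] e
    by (auto intro!: antisym)
qed

text \<open>Rounding every coordinate of \<eta> down to the lattice gives the only k with \<eta> - k
  in the half-open cell. In integral form the partition can be inserted as a factor 1.\<close>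

lemma cell_tiling:
  fixes \<eta> :: "real ^ 'd"
  assumes "N > 0"
  shows "(\<integral>\<^sup>+ k. indicator (cell N) (\<eta> - k) \<partial>count_space (lat N)) = 1"
proof -
  define k0 :: "real ^ 'd" where "k0 = (\<chi> i. of_int \<lfloor>2 * N * (\<eta> $ i)\<rfloor> / (2 * N))"
  have k0: "k0 \<in> lat N" using assms by (simp add: k0_def lat_def)
  have "\<eta> - k \<in> cell N \<longleftrightarrow> k = k0" if k: "k \<in> lat N" for k
  proof -
    have "0 \<le> (\<eta> - k) $ i \<and> (\<eta> - k) $ i < 1 / (2 * N) \<longleftrightarrow> k $ i = k0 $ i" for i
    proof -
      obtain n :: int where n: "2 * N * (k $ i) = of_int n"
        using k by (auto simp: lat_def elim: Ints_cases)
      then have kn: "k $ i = of_int n / (2 * N)" using assms by (simp add: field_simps)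
      have "0 \<le> (\<eta> - k) $ i \<and> (\<eta> - k) $ i < 1 / (2 * N)
          \<longleftrightarrow> of_int n \<le> 2 * N * (\<eta> $ i) \<and> 2 * N * (\<eta> $ i) < of_int n + 1"
      proof -
        have "(\<eta> - k) $ i < 1 / (2 * N) \<longleftrightarrow> \<eta> $ i < (of_int n + 1) / (2 * N)"
          by (simp add: kn add_divide_distrib) linarith
        also have "\<dots> \<longleftrightarrow> 2 * N * (\<eta> $ i) < of_int n + 1"
          using assms by (simp add: pos_less_divide_eq mult.commute)
        finally show ?thesis using assms by (simp add: kn pos_divide_le_eq mult.commute)
      qed
      also have "\<dots> \<longleftrightarrow> \<lfloor>2 * N * (\<eta> $ i)\<rfloor> = n" by (simp add: floor_eq_iff)
      also have "\<dots> \<longleftrightarrow> k $ i = k0 $ i" using assms by (auto simp: kn k0_def)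
      finally show ?thesis .
    qed
    then show ?thesis by (simp add: cell_def vec_eq_iff)
  qed
  then have "(\<integral>\<^sup>+ k. indicator (cell N) (\<eta> - k) \<partial>count_space (lat N))
      = (\<integral>\<^sup>+ k. indicator {k0} k \<partial>count_space (lat N))"
    by (intro nn_integral_cong) (simp add: indicator_def)
  also have "\<dots> = 1" using k0 by (subst nn_integral_indicator) (auto simp: emeasure_count_space)
  finally show ?thesis .
qed

text \<open>Frequency space is cut into lattice translates of \<open>cell N\<close>. For each t in
  the cell, Parseval for the modulated function evaluates the sum over the shifted lattice as (2N)^d
  times the squared norm, independently of t. The cell has measure 1 / (2N)^d, so the factors
  cancel.\<close>

lemma plancherel:
  fixes h :: "real ^ 'd \<Rightarrow> complex"
  assumes \<Omega>: "bounded \<Omega>" "\<Omega> \<in> sets lebesgue" and h: "h \<in> L2 \<Omega>"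
  shows "(\<integral>\<^sup>+ \<eta>. ennreal ((cmod (ft \<Omega> h \<eta>))\<^sup>2) \<partial>lborel) = ennreal ((L2_norm \<Omega> h)\<^sup>2)"
proof -
  obtain N where N: "N > 0" "\<Omega> \<subseteq> cube N" using bounded_subset_cube[OF \<Omega>(1)] .
  let ?L = "count_space (lat N :: (real ^ 'd) set)"
  note cnt = lat_countable[OF N(1), where 'd='d]
  define \<phi> where "\<phi> \<eta> = ennreal ((cmod (ft \<Omega> h \<eta>))\<^sup>2)" for \<eta>
  have [measurable]: "ft \<Omega> h \<in> borel_measurable borel"
    by (rule ft_measurable[OF lebesgue_on_bounded_finite[OF \<Omega>] L2_measurable[OF h]])
  have [measurable]: "\<phi> \<in> borel_measurable borel" unfolding \<phi>_def by measurable
  have "(\<integral>\<^sup>+ \<eta>. \<phi> \<eta> \<partial>lborel) = (\<integral>\<^sup>+ \<eta>. \<integral>\<^sup>+ k. \<phi> \<eta> * indicator (cell N) (\<eta> - k) \<partial>?L \<partial>lborel)"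
    by (simp add: nn_integral_cmult cell_tiling N)
  also have "\<dots> = (\<integral>\<^sup>+ k. \<integral>\<^sup>+ \<eta>. \<phi> \<eta> * indicator (cell N) (\<eta> - k) \<partial>lborel \<partial>?L)"
    by (rule nn_integral_count_space_nn_integral[OF cnt]) measurable
  also have "\<dots> = (\<integral>\<^sup>+ k. \<integral>\<^sup>+ t. \<phi> (k + t) * indicator (cell N) t \<partial>lborel \<partial>?L)"
  proof (rule nn_integral_cong)
    fix k :: "real ^ 'd"
    show "(\<integral>\<^sup>+ \<eta>. \<phi> \<eta> * indicator (cell N) (\<eta> - k) \<partial>lborel) = (\<integral>\<^sup>+ t. \<phi> (k + t) * indicator (cell N) t \<partial>lborel)"
      using nn_integral_lborel_translate[of "\<lambda>\<eta>. \<phi> \<eta> * indicator (cell N) (\<eta> - k)" k] by simp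
  qed
  also have "\<dots> = (\<integral>\<^sup>+ t. \<integral>\<^sup>+ k. \<phi> (k + t) * indicator (cell N) t \<partial>?L \<partial>lborel)"
    by (rule nn_integral_count_space_nn_integral[OF cnt, symmetric]) measurable
  also have "\<dots> = (\<integral>\<^sup>+ t. ennreal ((2 * N) ^ CARD('d) * (L2_norm \<Omega> h)\<^sup>2) * indicator (cell N) (t :: real ^ 'd) \<partial>lborel)"
  proof (rule nn_integral_cong)
    fix t :: "real ^ 'd"
    have "(\<integral>\<^sup>+ k. \<phi> (k + t) \<partial>?L) = ennreal ((2 * N) ^ CARD('d) * (L2_norm \<Omega> h)\<^sup>2)"
      using parseval[OF N(1) \<Omega>(2) N(2) L2_modulate[OF h], of t] infsum_eq_nn_integral_count_space[OF cnt]
      by (simp add: \<phi>_def ft_add L2_norm_modulate)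
    then show "(\<integral>\<^sup>+ k. \<phi> (k + t) * indicator (cell N) t \<partial>?L)
        = ennreal ((2 * N) ^ CARD('d) * (L2_norm \<Omega> h)\<^sup>2) * indicator (cell N) t"
      by (simp add: nn_integral_multc)
  qed
  also have "\<dots> = ennreal ((2 * N) ^ CARD('d) * (L2_norm \<Omega> h)\<^sup>2) * ennreal (1 / (2 * N) ^ CARD('d))"
    by (simp add: nn_integral_cmult emeasure_cell N)
  also have "\<dots> = ennreal ((L2_norm \<Omega> h)\<^sup>2)"
    using N by (subst ennreal_mult[symmetric]) auto
  finally show ?thesis by (simp add: \<phi>_def)
qed

lemma ball_sets [measurable]: "ball a r \<in> sets borel"
  by simp

lemma emeasure_lborel_ball: "emeasure lborel (ball a r) = ennreal (measure lborel (ball a r))"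
  using emeasure_lborel_ball_finite[of a r] by (intro emeasure_eq_ennreal_measure) auto

lemma measure_ball_scale:
  fixes a :: "'a::euclidean_space"
  assumes "L > 0"
  shows "measure lborel (ball a (2 * L)) = 2 ^ DIM('a) * measure lborel (ball (0::'a) L)"
  using assms by (simp add: content_ball power_mult_distrib)

section \<open>Density of the frequencies and frame bounds\<close>

text \<open>The product f * cnj g is the indicator of \<open>S\<close>, so Plancherel knows the
  total mass \<open>s\<close> of its squared transform, and a fixed ball of radius n holds more than
  s / 2. Once L \<ge> n, every frequency in \<open>ball \<eta> L\<close> contributes at least s / 2
  to an integral over a ball of radius 2L, while Bessel bounds the integrand by B s / T^2. The half
  gives the factor 2, the doubled radius the power of 2.\<close>

lemma bessel_density:
  fixes g :: "real ^ 'd \<Rightarrow> complex"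
  assumes \<Omega>: "bounded \<Omega>" "\<Omega> \<in> sets lebesgue" and g: "g \<in> borel_measurable (lebesgue_on \<Omega>)"
    and T: "T > 0" "\<not> (AE x in lebesgue_on \<Omega>. cmod (g x) < T)"
    and bessel: "\<And>f F. f \<in> L2 \<Omega> \<Longrightarrow> finite F \<Longrightarrow> F \<subseteq> \<Lambda> \<Longrightarrow>
      (\<Sum>l\<in>F. (cmod (ft \<Omega> (\<lambda>x. f x * cnj (g x)) l))\<^sup>2) \<le> B * (L2_norm \<Omega> f)\<^sup>2"
    and B: "B > 0"
  shows "\<exists>L0. \<forall>L\<ge>L0. L > 0 \<longrightarrow> (\<forall>\<eta> F. finite F \<longrightarrow> F \<subseteq> \<Lambda> \<inter> ball \<eta> L \<longrightarrow>
    real (card F) \<le> 2 ^ CARD('d) * (2 * B / T\<^sup>2) * measure lborel (ball (0 :: real ^ 'd) L))"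
proof -
  let ?M = "lebesgue_on \<Omega>"
  note [measurable] = g
  note fin = lebesgue_on_bounded_finite[OF \<Omega>]
  interpret finite_measure ?M by (rule fin)
  define S where "S = {x \<in> space ?M. T \<le> cmod (g x)}"
  have [measurable]: "S \<in> sets ?M" unfolding S_def by measurable
  have S_Int [simp]: "S \<inter> \<Omega> = S" by (auto simp: S_def)
  define s where "s = measure ?M S"
  have "emeasure ?M S \<noteq> 0"
  proof
    assume "emeasure ?M S = 0"
    then have "AE x in ?M. \<not> T \<le> cmod (g x)"
      using \<open>S \<in> sets ?M\<close> by (intro AE_I[of _ _ S]) (auto simp: S_def)
    then show False using T(2) by (simp add: not_le)
  qed
  then have s: "s > 0" by (simp add: s_def emeasure_eq_measure zero_less_measure_iff)
  define f where "f x = (if x \<in> S then inverse (cnj (g x)) else 0)" for x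
  have f_le: "cmod (f x) \<le> 1 / T" for x
    using T(1) by (auto simp: f_def S_def norm_divide inverse_eq_divide intro!: frac_le)
  have f_meas: "f \<in> borel_measurable ?M" unfolding f_def by measurable
  have f: "f \<in> L2 \<Omega>" by (rule L2_bounded[OF fin f_meas f_le])
  have fg: "f x * cnj (g x) = indicator S x" for x
  proof -
    have "g x \<noteq> 0" if "x \<in> S" using that T(1) by (auto simp: S_def)
    then show ?thesis by (simp add: f_def indicator_def)
  qed
  have f_norm: "(L2_norm \<Omega> f)\<^sup>2 \<le> s / T\<^sup>2"
  proof -
    have "(L2_norm \<Omega> f)\<^sup>2 \<le> (LINT x|?M. (1 / T\<^sup>2) * indicator S x)"
      unfolding L2_norm_power2
    proof (rule integral_mono)
      show "(cmod (f x))\<^sup>2 \<le> (1 / T\<^sup>2) * indicator S x" for x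
        using power_mono[OF f_le[of x], of 2] by (auto simp: f_def power_divide)
    qed (use L2_integrable[OF f] in \<open>auto simp: emeasure_eq_measure\<close>)
    then show ?thesis by (simp add: s_def)
  qed
  have ind: "(\<lambda>x. indicator S x :: complex) \<in> L2 \<Omega>"
    by (rule L2_bounded[OF fin, where C = 1]) (auto simp: indicator_def)
  have ind_norm: "(L2_norm \<Omega> (indicator S))\<^sup>2 = s"
  proof -
    have "(L2_norm \<Omega> (indicator S))\<^sup>2 = (LINT x|?M. indicator S x)"
      unfolding L2_norm_power2 by (intro Bochner_Integration.integral_cong) (auto simp: indicator_def)
    then show ?thesis by (simp add: s_def)
  qed
  define \<phi> where "\<phi> \<eta> = ennreal ((cmod (ft \<Omega> (indicator S) \<eta>))\<^sup>2)" for \<eta>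
  have [measurable]: "ft \<Omega> (indicator S) \<in> borel_measurable borel"
    by (rule ft_measurable[OF fin L2_measurable[OF ind]])
  have \<phi> [measurable]: "\<phi> \<in> borel_measurable borel" unfolding \<phi>_def by measurable
  have total: "(\<integral>\<^sup>+ \<eta>. \<phi> \<eta> \<partial>lborel) = ennreal s"
    using plancherel[OF \<Omega> ind] by (simp add: \<phi>_def ind_norm)
  obtain n :: nat where n: "ennreal (s / 2) < (\<integral>\<^sup>+ \<eta>. \<phi> \<eta> * indicator (ball 0 (real n)) \<eta> \<partial>lborel)"
  proof -
    have "(\<integral>\<^sup>+ \<eta>. \<phi> \<eta> \<partial>lborel) = (\<integral>\<^sup>+ \<eta>. (SUP n. \<phi> \<eta> * indicator (ball 0 (real n)) \<eta>) \<partial>lborel)"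
    proof (rule nn_integral_cong)
      fix \<eta> :: "real ^ 'd"
      obtain n :: nat where "norm \<eta> < real n" using reals_Archimedean2 by blast
      then show "\<phi> \<eta> = (SUP n. \<phi> \<eta> * indicator (ball 0 (real n)) \<eta>)"
        by (intro antisym SUP_upper2[of n] SUP_least) (auto simp: indicator_def)
    qed
    also have "\<dots> = (SUP n. \<integral>\<^sup>+ \<eta>. \<phi> \<eta> * indicator (ball 0 (real n)) \<eta> \<partial>lborel)"
      by (rule nn_integral_monotone_convergence_SUP)
        (auto simp: incseq_def le_fun_def indicator_def)
    finally have "(SUP n. \<integral>\<^sup>+ \<eta>. \<phi> \<eta> * indicator (ball 0 (real n)) \<eta> \<partial>lborel) = ennreal s"
      using total by simp
    moreover have "ennreal (s / 2) < ennreal s" using s by (simp add: ennreal_less_iff)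
    ultimately have "ennreal (s / 2) < (SUP n. \<integral>\<^sup>+ \<eta>. \<phi> \<eta> * indicator (ball 0 (real n)) \<eta> \<partial>lborel)"
      by simp
    then show ?thesis using that by (auto simp: less_SUP_iff)
  qed
  show ?thesis
  proof (intro exI[of _ "real n"] allI impI)
    fix L :: real and \<eta> :: "real ^ 'd" and F
    assume L: "real n \<le> L" "L > 0" and F: "finite F" "F \<subseteq> \<Lambda> \<inter> ball \<eta> L"
    define a where "a = measure lborel (ball (0 :: real ^ 'd) L)"
    have "ennreal (real (card F) * (s / 2)) = (\<Sum>l\<in>F. ennreal (s / 2))"
      using s by (subst sum_ennreal) auto
    also have "\<dots> \<le> (\<Sum>l\<in>F. \<integral>\<^sup>+ \<xi>. \<phi> (l + \<xi>) * indicator (ball (- \<eta>) (2 * L)) \<xi> \<partial>lborel)"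
    proof (rule sum_mono)
      fix l assume l: "l \<in> F"
      have "ennreal (s / 2) \<le> (\<integral>\<^sup>+ u. \<phi> u * indicator (ball 0 (real n)) u \<partial>lborel)"
        using n by simp
      also have "\<dots> = (\<integral>\<^sup>+ \<xi>. \<phi> (l + \<xi>) * indicator (ball 0 (real n)) (l + \<xi>) \<partial>lborel)"
        using nn_integral_lborel_translate[of "\<lambda>u. \<phi> u * indicator (ball 0 (real n)) u" l] by simp
      also have "\<dots> \<le> (\<integral>\<^sup>+ \<xi>. \<phi> (l + \<xi>) * indicator (ball (- \<eta>) (2 * L)) \<xi> \<partial>lborel)"
      proof (intro nn_integral_mono mult_left_mono)
        fix \<xi> :: "real ^ 'd"
        \<comment> \<open>Since l is within L of \<eta>, a shift \<xi> that moves l into the ball of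
          radius n about 0 lies within n + L \<le> 2 L of - \<eta>.\<close>
        have "dist (- \<eta>) \<xi> < 2 * L" if "norm (l + \<xi>) < real n"
        proof -
          have "norm (\<eta> - l) < L" using F l by (auto simp: dist_norm)
          moreover have "dist (- \<eta>) \<xi> = norm ((l + \<xi>) + (\<eta> - l))"
            by (simp add: dist_norm norm_minus_commute[of "- \<eta>" \<xi>])
          ultimately show ?thesis using norm_triangle_ineq[of "l + \<xi>" "\<eta> - l"] that L by linarith
        qed
        then show "indicator (ball 0 (real n)) (l + \<xi>) \<le> (indicator (ball (- \<eta>) (2 * L)) \<xi> :: ennreal)"
          by (auto simp: indicator_def)
      qed simp
      finally show "ennreal (s / 2) \<le> (\<integral>\<^sup>+ \<xi>. \<phi> (l + \<xi>) * indicator (ball (- \<eta>) (2 * L)) \<xi> \<partial>lborel)" .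
    qed
    also have "\<dots> = (\<integral>\<^sup>+ \<xi>. (\<Sum>l\<in>F. \<phi> (l + \<xi>) * indicator (ball (- \<eta>) (2 * L)) \<xi>) \<partial>lborel)"
      by (rule nn_integral_sum[symmetric]) measurable
    also have "\<dots> \<le> (\<integral>\<^sup>+ \<xi>. ennreal (B * (s / T\<^sup>2)) * indicator (ball (- \<eta>) (2 * L)) \<xi> \<partial>lborel)"
    proof (rule nn_integral_mono)
      fix \<xi> :: "real ^ 'd"
      \<comment> \<open>Read through \<open>ft_add\<close>, these are coefficients of the modulated
        \<open>f\<close> against \<open>g\<close>, so the Bessel bound holds for every \<xi> with
        the same constant.\<close>
      have "(\<Sum>l\<in>F. (cmod (ft \<Omega> (indicator S) (l + \<xi>)))\<^sup>2)
          = (\<Sum>l\<in>F. (cmod (ft \<Omega> (\<lambda>x. (f x * cnj (echar \<xi> x)) * cnj (g x)) l))\<^sup>2)"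
        by (simp add: ft_add fg[symmetric] mult_ac)
      also have "\<dots> \<le> B * (L2_norm \<Omega> f)\<^sup>2"
        using bessel[OF L2_modulate[OF f, of \<xi>], of F] F by (simp add: L2_norm_modulate)
      also have "\<dots> \<le> B * (s / T\<^sup>2)" using f_norm B by (intro mult_left_mono) auto
      finally have "(\<Sum>l\<in>F. \<phi> (l + \<xi>)) \<le> ennreal (B * (s / T\<^sup>2))"
        unfolding \<phi>_def by (subst sum_ennreal) (auto intro: ennreal_leI)
      then show "(\<Sum>l\<in>F. \<phi> (l + \<xi>) * indicator (ball (- \<eta>) (2 * L)) \<xi>)
          \<le> ennreal (B * (s / T\<^sup>2)) * indicator (ball (- \<eta>) (2 * L)) \<xi>"
        unfolding sum_distrib_right[symmetric] by (rule mult_right_mono) simp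
    qed
    also have "\<dots> = ennreal (B * (s / T\<^sup>2)) * emeasure lborel (ball (- \<eta>) (2 * L))"
      by (rule nn_integral_cmult_indicator) simp
    also have "emeasure lborel (ball (- \<eta>) (2 * L)) = ennreal (2 ^ CARD('d) * a)"
      using measure_ball_scale[OF L(2), of "- \<eta>"] by (simp add: emeasure_lborel_ball a_def)
    also have "ennreal (B * (s / T\<^sup>2)) * ennreal (2 ^ CARD('d) * a) = ennreal (B * (s / T\<^sup>2) * (2 ^ CARD('d) * a))"
      using B s by (intro ennreal_mult[symmetric]) (auto simp: a_def)
    finally have "real (card F) * (s / 2) \<le> B * (s / T\<^sup>2) * (2 ^ CARD('d) * a)"
      using B s by (subst (asm) ennreal_le_iff) (auto simp: a_def)
    \<comment> \<open>The measure of \<open>S\<close> cancels, so the bound depends on the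
      superlevel set only through \<open>T\<close>.\<close>
    then have "(s / 2) * real (card F) \<le> (s / 2) * (2 ^ CARD('d) * (2 * B / T\<^sup>2) * a)"
      by (simp add: mult_ac)
    then show "real (card F) \<le> 2 ^ CARD('d) * (2 * B / T\<^sup>2) * measure lborel (ball (0 :: real ^ 'd) L)"
      unfolding a_def by (rule mult_left_le_imp_le) (use s in simp)
  qed
qed

text \<open>Tonelli and the substitution u = l + \<xi> rewrite the left side as the integral of |ft
  h u|^2 times the number of points of \<Lambda> in \<open>ball u L\<close>. The count is at most
  \<open>n\<close> uniformly in u, and Plancherel integrates the rest.\<close>

lemma mean_coefficients_le:
  fixes h :: "real ^ 'd \<Rightarrow> complex"
  assumes \<Omega>: "bounded \<Omega>" "\<Omega> \<in> sets lebesgue" and h: "h \<in> L2 \<Omega>"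
    and \<Lambda>: "countable \<Lambda>" and n: "n \<ge> 0"
    and card: "\<And>\<eta> F. finite F \<Longrightarrow> F \<subseteq> \<Lambda> \<inter> ball \<eta> L \<Longrightarrow> real (card F) \<le> n"
  shows "(\<integral>\<^sup>+ \<xi>. (\<Sum>\<^sub>\<infinity>l\<in>\<Lambda>. ennreal ((cmod (ft \<Omega> h (l + \<xi>)))\<^sup>2)) * indicator (ball 0 L) \<xi> \<partial>lborel)
    \<le> ennreal (n * (L2_norm \<Omega> h)\<^sup>2)"
proof -
  define \<phi> where "\<phi> \<eta> = ennreal ((cmod (ft \<Omega> h \<eta>))\<^sup>2)" for \<eta>
  have [measurable]: "ft \<Omega> h \<in> borel_measurable borel"
    by (rule ft_measurable[OF lebesgue_on_bounded_finite[OF \<Omega>] L2_measurable[OF h]])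
  have [measurable]: "\<phi> \<in> borel_measurable borel" unfolding \<phi>_def by measurable
  have "(\<integral>\<^sup>+ \<xi>. (\<Sum>\<^sub>\<infinity>l\<in>\<Lambda>. \<phi> (l + \<xi>)) * indicator (ball 0 L) \<xi> \<partial>lborel)
      = (\<integral>\<^sup>+ \<xi>. \<integral>\<^sup>+ l. \<phi> (l + \<xi>) * indicator (ball 0 L) \<xi> \<partial>count_space \<Lambda> \<partial>lborel)"
    by (simp add: infsum_eq_nn_integral_count_space[OF \<Lambda>] nn_integral_multc)
  also have "\<dots> = (\<integral>\<^sup>+ l. \<integral>\<^sup>+ \<xi>. \<phi> (l + \<xi>) * indicator (ball 0 L) \<xi> \<partial>lborel \<partial>count_space \<Lambda>)"
    by (rule nn_integral_count_space_nn_integral[OF \<Lambda>]) measurable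
  also have "\<dots> = (\<integral>\<^sup>+ l. \<integral>\<^sup>+ u. \<phi> u * indicator (ball 0 L) (u - l) \<partial>lborel \<partial>count_space \<Lambda>)"
  proof (rule nn_integral_cong)
    fix l :: "real ^ 'd"
    show "(\<integral>\<^sup>+ \<xi>. \<phi> (l + \<xi>) * indicator (ball 0 L) \<xi> \<partial>lborel) = (\<integral>\<^sup>+ u. \<phi> u * indicator (ball 0 L) (u - l) \<partial>lborel)"
      using nn_integral_lborel_translate[of "\<lambda>u. \<phi> u * indicator (ball 0 L) (u - l)" l] by simp
  qed
  also have "\<dots> = (\<integral>\<^sup>+ u. \<integral>\<^sup>+ l. \<phi> u * indicator (ball 0 L) (u - l) \<partial>count_space \<Lambda> \<partial>lborel)"
    by (rule nn_integral_count_space_nn_integral[OF \<Lambda>, symmetric]) measurable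
  also have "\<dots> \<le> (\<integral>\<^sup>+ u. \<phi> u * ennreal n \<partial>lborel)"
  proof (rule nn_integral_mono)
    fix u :: "real ^ 'd"
    have "(\<Sum>\<^sub>\<infinity>l\<in>\<Lambda>. indicator (ball 0 L) (u - l)) \<le> ennreal n"
    proof (rule infsum_le_finite_sums)
      fix F assume F: "finite F" "F \<subseteq> \<Lambda>"
      \<comment> \<open>Finite subsets suffice to bound the infinite sum, which fits the form of the
        hypothesis \<open>card\<close>.\<close>
      have "(\<Sum>l\<in>F. indicator (ball 0 L) (u - l) :: ennreal) = (\<Sum>l\<in>F \<inter> ball u L. 1)"
        using F by (intro sum.mono_neutral_cong_right) (auto simp: indicator_def dist_norm norm_minus_commute)
      also have "\<dots> = ennreal (real (card (F \<inter> ball u L)))"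
        by (simp add: ennreal_of_nat_eq_real_of_nat)
      also have "\<dots> \<le> ennreal n" using F by (intro ennreal_leI card[of _ u]) auto
      finally show "(\<Sum>l\<in>F. indicator (ball 0 L) (u - l)) \<le> ennreal n" .
    qed (rule nonneg_summable_on_complete, simp)
    then show "(\<integral>\<^sup>+ l. \<phi> u * indicator (ball 0 L) (u - l) \<partial>count_space \<Lambda>) \<le> \<phi> u * ennreal n"
      by (simp add: infsum_eq_nn_integral_count_space[OF \<Lambda>] nn_integral_cmult mult_left_mono)
  qed
  also have "\<dots> = ennreal ((L2_norm \<Omega> h)\<^sup>2) * ennreal n"
    using plancherel[OF \<Omega> h] by (simp add: nn_integral_multc \<phi>_def)
  also have "\<dots> = ennreal (n * (L2_norm \<Omega> h)\<^sup>2)"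
    using n by (simp add: ennreal_mult mult.commute)
  finally show ?thesis by (simp add: \<phi>_def)
qed

text \<open>The thresholds \<open>T j\<close> are free among levels that |g_j| reaches on a set of
  positive measure. The caller can therefore make the term of an unbounded g_j as small as desired,
  even after \<open>f\<close> has been fixed.\<close>

lemma frame_mean_lower_bound:
  fixes g :: "nat \<Rightarrow> real ^ 'd \<Rightarrow> complex"
  assumes \<Omega>: "bounded \<Omega>" "\<Omega> \<in> sets lebesgue"
    and g: "\<And>j. j \<in> {1..q} \<Longrightarrow> g j \<in> borel_measurable (lebesgue_on \<Omega>)"
    and \<Lambda>: "\<And>j. j \<in> {1..q} \<Longrightarrow> countable (\<Lambda> j)"
    and A: "A > 0" and B: "B > 0"
    and lower: "\<And>f. f \<in> L2 \<Omega> \<Longrightarrow> ennreal (A * (L2_norm \<Omega> f)\<^sup>2)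
      \<le> (\<Sum>j = 1..q. \<Sum>\<^sub>\<infinity>l\<in>\<Lambda> j. ennreal ((cmod (ft \<Omega> (\<lambda>x. f x * cnj (g j x)) l))\<^sup>2))"
    and upper: "\<And>f. f \<in> L2 \<Omega> \<Longrightarrow>
      (\<Sum>j = 1..q. \<Sum>\<^sub>\<infinity>l\<in>\<Lambda> j. ennreal ((cmod (ft \<Omega> (\<lambda>x. f x * cnj (g j x)) l))\<^sup>2))
      \<le> ennreal (B * (L2_norm \<Omega> f)\<^sup>2)"
    and T: "\<And>j. j \<in> {1..q} \<Longrightarrow> T j > 0"
      "\<And>j. j \<in> {1..q} \<Longrightarrow> \<not> (AE x in lebesgue_on \<Omega>. cmod (g j x) < T j)"
    and f: "f \<in> L2 \<Omega>" "\<And>j. j \<in> {1..q} \<Longrightarrow> (\<lambda>x. f x * cnj (g j x)) \<in> L2 \<Omega>"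
  shows "A * (L2_norm \<Omega> f)\<^sup>2
    \<le> (\<Sum>j = 1..q. 2 ^ CARD('d) * (2 * B / (T j)\<^sup>2) * (L2_norm \<Omega> (\<lambda>x. f x * cnj (g j x)))\<^sup>2)"
proof -
  define c where "c j = 2 ^ CARD('d) * (2 * B / (T j)\<^sup>2)" for j
  have c: "c j \<ge> 0" for j using B by (simp add: c_def)
  have bessel: "(\<Sum>l\<in>F. (cmod (ft \<Omega> (\<lambda>x. f x * cnj (g j x)) l))\<^sup>2) \<le> B * (L2_norm \<Omega> f)\<^sup>2"
    if j: "j \<in> {1..q}" and f: "f \<in> L2 \<Omega>" and F: "finite F" "F \<subseteq> \<Lambda> j" for j f F
  proof -
    let ?t = "\<lambda>j l. ennreal ((cmod (ft \<Omega> (\<lambda>x. f x * cnj (g j x)) l))\<^sup>2)"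
    have "ennreal (\<Sum>l\<in>F. (cmod (ft \<Omega> (\<lambda>x. f x * cnj (g j x)) l))\<^sup>2) = infsum (?t j) F"
      using F by (simp add: sum_ennreal)
    also have "\<dots> \<le> infsum (?t j) (\<Lambda> j)"
      using F by (intro infsum_mono_neutral nonneg_summable_on_complete) auto
    also have "\<dots> \<le> (\<Sum>j = 1..q. infsum (?t j) (\<Lambda> j))"
      using j by (intro member_le_sum) auto
    also have "\<dots> \<le> ennreal (B * (L2_norm \<Omega> f)\<^sup>2)" using upper[OF f] .
    finally show ?thesis using B by (subst (asm) ennreal_le_iff) auto
  qed
  have "\<exists>L0. \<forall>L\<ge>L0. L > 0 \<longrightarrow> (\<forall>\<eta> F. finite F \<longrightarrow> F \<subseteq> \<Lambda> j \<inter> ball \<eta> L \<longrightarrow>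
      real (card F) \<le> c j * measure lborel (ball (0 :: real ^ 'd) L))" if j: "j \<in> {1..q}" for j
    unfolding c_def using bessel_density[OF \<Omega> g[OF j] T(1)[OF j] T(2)[OF j] bessel[OF j] B] by blast
  then obtain L0 where L0: "\<And>j L \<eta> F. j \<in> {1..q} \<Longrightarrow> L \<ge> L0 j \<Longrightarrow> L > 0 \<Longrightarrow> finite F \<Longrightarrow>
      F \<subseteq> \<Lambda> j \<inter> ball \<eta> L \<Longrightarrow> real (card F) \<le> c j * measure lborel (ball (0 :: real ^ 'd) L)"
    by metis
  \<comment> \<open>One radius beyond all thresholds \<open>L0 j\<close>; the added 1 makes it
    positive even if the sum is 0.\<close>
  define L where "L = (\<Sum>j = 1..q. \<bar>L0 j\<bar>) + 1"
  have L: "L > 0" by (simp add: L_def add_nonneg_pos sum_nonneg)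
  have L_ge: "L \<ge> L0 j" if "j \<in> {1..q}" for j
  proof -
    have "L0 j \<le> \<bar>L0 j\<bar>" by simp
    also have "\<dots> \<le> (\<Sum>j = 1..q. \<bar>L0 j\<bar>)" using that by (intro member_le_sum) auto
    finally show ?thesis by (simp add: L_def)
  qed
  define a where "a = measure lborel (ball (0 :: real ^ 'd) L)"
  have a: "a > 0" using L by (simp add: a_def)
  define h where "h j x = f x * cnj (g j x)" for j x
  have h: "h j \<in> L2 \<Omega>" if "j \<in> {1..q}" for j using f(2)[OF that] by (simp add: h_def[abs_def])
  define \<Phi> where "\<Phi> j \<xi> = (\<Sum>\<^sub>\<infinity>l\<in>\<Lambda> j. ennreal ((cmod (ft \<Omega> (h j) (l + \<xi>)))\<^sup>2))" for j \<xi>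
  have \<Phi>_meas [measurable]: "\<Phi> j \<in> borel_measurable borel" if j: "j \<in> {1..q}" for j
  proof -
    have [measurable]: "ft \<Omega> (h j) \<in> borel_measurable borel"
      by (rule ft_measurable[OF lebesgue_on_bounded_finite[OF \<Omega>] L2_measurable[OF h[OF j]]])
    interpret sigma_finite_measure "count_space (\<Lambda> j)"
      using \<Lambda>[OF j] by (rule sigma_finite_measure_count_space_countable)
    \<comment> \<open>As the frequency ranges over a countable set, joint measurability follows from
      measurability in \<xi> for each fixed l.\<close>
    have "(\<lambda>z. ennreal ((cmod (ft \<Omega> (h j) (snd z + fst z)))\<^sup>2))
        \<in> borel_measurable (borel \<Otimes>\<^sub>M count_space (\<Lambda> j))"
      by (rule measurable_compose_countable'[where g = snd and I = "\<Lambda> j"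
            and f = "\<lambda>l z. ennreal ((cmod (ft \<Omega> (h j) (l + fst z)))\<^sup>2)"])
        (measurable, rule \<Lambda>[OF j])
    then have "(\<lambda>\<xi>. \<integral>\<^sup>+ l. ennreal ((cmod (ft \<Omega> (h j) (l + \<xi>)))\<^sup>2) \<partial>count_space (\<Lambda> j)) \<in> borel_measurable borel"
      by (intro borel_measurable_nn_integral) (simp add: case_prod_beta)
    then show ?thesis
      unfolding \<Phi>_def[abs_def] by (simp add: infsum_eq_nn_integral_count_space \<Lambda>[OF j])
  qed
  have "ennreal (A * (L2_norm \<Omega> f)\<^sup>2 * a) = ennreal (A * (L2_norm \<Omega> f)\<^sup>2) * emeasure lborel (ball (0 :: real ^ 'd) L)"
    using A a by (simp add: ennreal_mult a_def emeasure_lborel_ball)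
  also have "\<dots> = (\<integral>\<^sup>+ \<xi>. ennreal (A * (L2_norm \<Omega> f)\<^sup>2) * indicator (ball (0 :: real ^ 'd) L) \<xi> \<partial>lborel)"
    by (rule nn_integral_cmult_indicator[symmetric]) simp
  also have "\<dots> \<le> (\<integral>\<^sup>+ \<xi>. (\<Sum>j = 1..q. \<Phi> j \<xi> * indicator (ball 0 L) \<xi>) \<partial>lborel)"
  proof (rule nn_integral_mono)
    fix \<xi> :: "real ^ 'd"
    have "(\<lambda>x. f x * cnj (echar \<xi> x) * cnj (g j x)) = (\<lambda>x. h j x * cnj (echar \<xi> x))" for j
      by (simp add: h_def mult_ac)
    then have "ennreal (A * (L2_norm \<Omega> f)\<^sup>2) \<le> (\<Sum>j = 1..q. \<Phi> j \<xi>)"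
      using lower[OF L2_modulate[OF f(1), of \<xi>]] by (simp add: L2_norm_modulate \<Phi>_def ft_add)
    then show "ennreal (A * (L2_norm \<Omega> f)\<^sup>2) * indicator (ball (0 :: real ^ 'd) L) \<xi>
        \<le> (\<Sum>j = 1..q. \<Phi> j \<xi> * indicator (ball 0 L) \<xi>)"
      unfolding sum_distrib_right[symmetric] by (rule mult_right_mono) simp
  qed
  also have "\<dots> = (\<Sum>j = 1..q. \<integral>\<^sup>+ \<xi>. \<Phi> j \<xi> * indicator (ball 0 L) \<xi> \<partial>lborel)"
    by (rule nn_integral_sum) measurable
  also have "\<dots> \<le> (\<Sum>j = 1..q. ennreal (c j * a * (L2_norm \<Omega> (h j))\<^sup>2))"
    unfolding \<Phi>_def using L0 L L_ge a c
    by (intro sum_mono mean_coefficients_le \<Omega> h \<Lambda>) (auto simp: a_def)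
  also have "\<dots> = ennreal (\<Sum>j = 1..q. c j * a * (L2_norm \<Omega> (h j))\<^sup>2)"
    using a c by (intro sum_ennreal) auto
  finally have "A * (L2_norm \<Omega> f)\<^sup>2 * a \<le> (\<Sum>j = 1..q. c j * a * (L2_norm \<Omega> (h j))\<^sup>2)"
    using a c by (subst (asm) ennreal_le_iff) (auto intro!: sum_nonneg)
  also have "\<dots> = (\<Sum>j = 1..q. c j * (L2_norm \<Omega> (h j))\<^sup>2) * a"
    unfolding sum_distrib_right by (intro sum.cong) (simp_all add: mult_ac)
  finally have "A * (L2_norm \<Omega> f)\<^sup>2 \<le> (\<Sum>j = 1..q. c j * (L2_norm \<Omega> (h j))\<^sup>2)"
    using a by simp
  then show ?thesis by (simp add: c_def h_def[abs_def])
qed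

section \<open>Necessity of the lower bound\<close>

lemma L2_norm_mult_indicator_le:
  fixes g :: "real ^ 'd \<Rightarrow> complex"
  assumes "finite_measure (lebesgue_on \<Omega>)" "E \<in> sets (lebesgue_on \<Omega>)"
    and g: "g \<in> borel_measurable (lebesgue_on \<Omega>)" and bound: "\<And>x. x \<in> E \<Longrightarrow> cmod (g x) \<le> C"
  shows "(\<lambda>x. indicator E x * cnj (g x)) \<in> L2 \<Omega>"
    and "(L2_norm \<Omega> (\<lambda>x. indicator E x * cnj (g x)))\<^sup>2 \<le> C\<^sup>2 * measure (lebesgue_on \<Omega>) E"
proof -
  interpret finite_measure "lebesgue_on \<Omega>" by fact
  note [measurable] = assms(2) g
  have [simp]: "E \<inter> \<Omega> = E" using sets.sets_into_space[OF assms(2)] by auto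
  show L2: "(\<lambda>x. indicator E x * cnj (g x)) \<in> L2 \<Omega>"
    \<comment> \<open>The value 0 off \<open>E\<close> must be bounded as well, and \<open>C\<close>
      may be negative when \<open>E\<close> is empty.\<close>
    by (rule L2_bounded[where C = "\<bar>C\<bar>"])
      (use assms bound in \<open>auto simp: indicator_def intro: order.trans[OF bound abs_ge_self]\<close>)
  have "(L2_norm \<Omega> (\<lambda>x. indicator E x * cnj (g x)))\<^sup>2 \<le> (LINT x|lebesgue_on \<Omega>. C\<^sup>2 * indicator E x)"
    unfolding L2_norm_power2
  proof (rule integral_mono)
    show "(cmod (indicator E x * cnj (g x)))\<^sup>2 \<le> C\<^sup>2 * indicator E x" for x
      using bound by (auto simp: indicator_def power_mono)
  qed (use L2_integrable[OF L2] in \<open>auto simp: emeasure_eq_measure\<close>)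
  then show "(L2_norm \<Omega> (\<lambda>x. indicator E x * cnj (g x)))\<^sup>2 \<le> C\<^sup>2 * measure (lebesgue_on \<Omega>) E"
    by simp
qed

text \<open>If |g| were almost everywhere below each 1 / (n + 1), it would vanish almost everywhere.
  The level obtained is the fixed threshold used for the indices in \<open>J\<close>.\<close>

lemma not_L2_zeroE:
  assumes "g \<in> L2 \<Omega> - L2_zero \<Omega>"
  obtains T where "T > 0" "\<not> (AE x in lebesgue_on \<Omega>. cmod (g x) < T)"
proof -
  have "AE x in lebesgue_on \<Omega>. g x = 0" if "\<And>T. T > 0 \<Longrightarrow> AE x in lebesgue_on \<Omega>. cmod (g x) < T"
  proof -
    have "AE x in lebesgue_on \<Omega>. \<forall>n::nat. cmod (g x) < inverse (real (Suc n))"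
      using that by (subst AE_all_countable) simp
    then show ?thesis
    proof eventually_elim
      case (elim x)
      show ?case
      proof (rule ccontr)
        assume "g x \<noteq> 0"
        then obtain n where "inverse (real (Suc n)) < cmod (g x)"
          using reals_Archimedean[of "cmod (g x)"] by auto
        then show False using elim[rule_format, of n] by linarith
      qed
    qed
  qed
  then show ?thesis using that assms by (auto simp: L2_zero_def)
qed

text \<open>The indicator of a set where every |g_j| with j in \<open>J\<close> is below m has small
  weighted norms for those j. The choices are made in the order: thresholds on \<open>J\<close>,
  then m, then the truncation level n, then the threshold t off \<open>J\<close>. A set of positive
  measure would yield A \<le> A / 2.\<close>

lemma frame_imp_max_lower_bound:
  fixes g :: "nat \<Rightarrow> real ^ 'd \<Rightarrow> complex"
  assumes \<Omega>: "bounded \<Omega>" "\<Omega> \<in> sets lebesgue"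
    and g: "\<And>j. j \<in> {1..q} \<Longrightarrow> g j \<in> L2 \<Omega> - L2_zero \<Omega>"
    and J: "J = {j \<in> {1..q}. Linf_norm \<Omega> (g j) < \<infinity>}"
    and \<Lambda>: "\<And>j. j \<in> {1..q} \<Longrightarrow> countable (\<Lambda> j)"
    and frame: "is_weighted_exp_frame \<Omega> q g \<Lambda>"
  shows "\<exists>m>0. AE x in lebesgue_on \<Omega>. max_over J (\<lambda>j. cmod (g j x)) \<ge> m"
proof -
  let ?M = "lebesgue_on \<Omega>"
  note fin = lebesgue_on_bounded_finite[OF \<Omega>]
  interpret finite_measure ?M by (rule fin)
  have gm: "g j \<in> borel_measurable ?M" if "j \<in> {1..q}" for j
    using g[OF that] L2_measurable by auto
  have J_sub: "J \<subseteq> {1..q}" and J_fin: "finite J" using J by auto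
  obtain A B where A: "A > 0" and B: "B > 0"
    and lower: "\<And>f. f \<in> L2 \<Omega> \<Longrightarrow> ennreal (A * (L2_norm \<Omega> f)\<^sup>2)
      \<le> (\<Sum>j = 1..q. \<Sum>\<^sub>\<infinity>l\<in>\<Lambda> j. ennreal ((cmod (ft \<Omega> (\<lambda>x. f x * cnj (g j x)) l))\<^sup>2))"
    and upper: "\<And>f. f \<in> L2 \<Omega> \<Longrightarrow>
      (\<Sum>j = 1..q. \<Sum>\<^sub>\<infinity>l\<in>\<Lambda> j. ennreal ((cmod (ft \<Omega> (\<lambda>x. f x * cnj (g j x)) l))\<^sup>2))
      \<le> ennreal (B * (L2_norm \<Omega> f)\<^sup>2)"
    using frame unfolding is_weighted_exp_frame_def L2_inner_weighted_exp by blast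
  define K where "K = 2 ^ CARD('d) * (2 * B)"
  have K: "K > 0" using B by (simp add: K_def)
  have "\<exists>T>0. \<not> (AE x in ?M. cmod (g j x) < T)" if "j \<in> {1..q}" for j
    using not_L2_zeroE[OF g[OF that]] by metis
  then obtain T where T: "\<And>j. j \<in> {1..q} \<Longrightarrow> T j > 0"
    "\<And>j. j \<in> {1..q} \<Longrightarrow> \<not> (AE x in ?M. cmod (g j x) < T j)"
    by metis
  have unbounded: "\<not> (AE x in ?M. cmod (g j x) < t)" if j: "j \<in> {1..q} - J" for j t
  proof
    assume "AE x in ?M. cmod (g j x) < t"
    then have "AE x in ?M. ennreal (cmod (g j x)) \<le> ennreal t"
      by eventually_elim (simp add: ennreal_leI)
    moreover have "(\<lambda>x. ennreal (cmod (g j x))) \<in> borel_measurable ?M"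
      using gm[of j] j by simp
    ultimately have "Linf_norm \<Omega> (g j) \<le> ennreal t" unfolding Linf_norm_def by (intro esssup_I)
    also have "\<dots> < \<infinity>" by simp
    finally show False using j J by auto
  qed
  define D where "D = (\<Sum>j\<in>J. K / (T j)\<^sup>2)"
  have D: "D \<ge> 0" using K by (auto simp: D_def intro!: sum_nonneg)
  \<comment> \<open>Chosen so that all indices in \<open>J\<close> together contribute at most A /
    4; the added 1 avoids dividing by 0 when D = 0, as for empty \<open>J\<close>.\<close>
  define m where "m = sqrt (A / (4 * (D + 1)))"
  have m: "m > 0" "D * m\<^sup>2 \<le> A / 4"
    using A D by (auto simp: m_def field_simps)
  \<comment> \<open>The truncation at n puts every product f * cnj g_j into \<open>L2\<close>, also
    for unbounded g_j. The sets exhaust the set where all |g_j| with j in \<open>J\<close> are below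
    m.\<close>
  define E where "E n = {x \<in> space ?M. (\<forall>j\<in>{1..q}. cmod (g j x) \<le> real n) \<and> (\<forall>j\<in>J. cmod (g j x) < m)}" for n :: nat
  have E_sets: "E n \<in> sets ?M" for n
  proof -
    have "{x \<in> space ?M. cmod (g j x) \<le> real n} \<in> sets ?M" "{x \<in> space ?M. cmod (g j x) < m} \<in> sets ?M"
      if "j \<in> {1..q}" for j
      using gm[OF that] by measurable
    then show ?thesis
      unfolding E_def using J_sub
      by (intro sets.sets_Collect_conj sets.sets_Collect_finite_All J_fin) auto
  qed
  have E_Int [simp]: "E n \<inter> \<Omega> = E n" for n by (auto simp: E_def)
  have E_null: "measure ?M (E n) = 0" for n
  proof (rule ccontr)
    assume "measure ?M (E n) \<noteq> 0"
    then have s: "measure ?M (E n) > 0" by (simp add: zero_less_measure_iff)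
    \<comment> \<open>Solves q K n^2 / t^2 \<le> A / 4, so that all indices outside \<open>J\<close>
      together contribute at most A / 4. The added 1 keeps t positive when n or q is 0.\<close>
    define t where "t = sqrt (4 * K * (real n)\<^sup>2 * real q / A + 1)"
    have t2: "t\<^sup>2 = 4 * K * (real n)\<^sup>2 * real q / A + 1"
      unfolding t_def using A K by (intro real_sqrt_pow2) auto
    have t: "t > 0" unfolding t_def using A K by (auto intro!: add_nonneg_pos)
    have t_bound: "real q * (K / t\<^sup>2 * (real n)\<^sup>2) \<le> A / 4"
    proof -
      have "4 * K * (real n)\<^sup>2 * real q \<le> A * t\<^sup>2" using A by (simp add: t2 field_simps)
      then show ?thesis using t by (simp add: field_simps)
    qed
    define T' where "T' j = (if j \<in> J then T j else t)" for j
    define f where "f = (indicator (E n) :: real ^ 'd \<Rightarrow> complex)"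
    have E1: "(L2_norm \<Omega> f)\<^sup>2 = measure ?M (E n)"
    proof -
      have "(L2_norm \<Omega> f)\<^sup>2 = (LINT x|?M. indicator (E n) x)"
        unfolding L2_norm_power2 f_def by (intro Bochner_Integration.integral_cong) (auto simp: indicator_def)
      then show ?thesis using E_sets by simp
    qed
    have fL2: "f \<in> L2 \<Omega>" unfolding f_def
      by (rule L2_bounded[OF fin, where C = 1]) (use E_sets in \<open>auto simp: indicator_def\<close>)
    have le_n: "(L2_norm \<Omega> (\<lambda>x. f x * cnj (g j x)))\<^sup>2 \<le> (real n)\<^sup>2 * measure ?M (E n)"
      and fg: "(\<lambda>x. f x * cnj (g j x)) \<in> L2 \<Omega>" if "j \<in> {1..q}" for j
      unfolding f_def using that
      by (intro L2_norm_mult_indicator_le[OF fin E_sets gm[OF that], where C = "real n"]; simp add: E_def)+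
    have le_m: "(L2_norm \<Omega> (\<lambda>x. f x * cnj (g j x)))\<^sup>2 \<le> m\<^sup>2 * measure ?M (E n)" if "j \<in> J" for j
      unfolding f_def using that J_sub
      by (intro L2_norm_mult_indicator_le[OF fin E_sets gm]) (auto simp: E_def less_imp_le)
    have "A * measure ?M (E n)
        \<le> (\<Sum>j = 1..q. K / (T' j)\<^sup>2 * (L2_norm \<Omega> (\<lambda>x. f x * cnj (g j x)))\<^sup>2)"
      using frame_mean_lower_bound[OF \<Omega> gm \<Lambda> A B lower upper, of T' f] T unbounded t fL2 fg
      by (auto simp: E1 T'_def K_def)
    also have "\<dots> = (\<Sum>j\<in>J. K / (T j)\<^sup>2 * (L2_norm \<Omega> (\<lambda>x. f x * cnj (g j x)))\<^sup>2)
        + (\<Sum>j\<in>{1..q} - J. K / t\<^sup>2 * (L2_norm \<Omega> (\<lambda>x. f x * cnj (g j x)))\<^sup>2)"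
      by (subst sum.subset_diff[OF J_sub]) (auto simp: T'_def intro!: sum.cong)
    also have "\<dots> \<le> (\<Sum>j\<in>J. K / (T j)\<^sup>2 * (m\<^sup>2 * measure ?M (E n)))
        + (\<Sum>j\<in>{1..q} - J. K / t\<^sup>2 * ((real n)\<^sup>2 * measure ?M (E n)))"
      using K le_m le_n by (intro add_mono sum_mono mult_left_mono) auto
    also have "\<dots> \<le> A / 4 * measure ?M (E n) + A / 4 * measure ?M (E n)"
    proof (rule add_mono)
      have "(\<Sum>j\<in>J. K / (T j)\<^sup>2 * (m\<^sup>2 * measure ?M (E n))) = D * m\<^sup>2 * measure ?M (E n)"
        unfolding D_def sum_distrib_right by (intro sum.cong) (simp_all add: mult_ac)
      then show "(\<Sum>j\<in>J. K / (T j)\<^sup>2 * (m\<^sup>2 * measure ?M (E n))) \<le> A / 4 * measure ?M (E n)"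
        using m(2) s by (simp only: mult_right_mono less_imp_le)
      have "(\<Sum>j\<in>{1..q} - J. K / t\<^sup>2 * ((real n)\<^sup>2 * measure ?M (E n)))
          \<le> (\<Sum>j\<in>{1..q}. K / t\<^sup>2 * ((real n)\<^sup>2 * measure ?M (E n)))"
        using K by (intro sum_mono2) auto
      also have "\<dots> = real q * (K / t\<^sup>2 * (real n)\<^sup>2) * measure ?M (E n)" by simp
      also have "\<dots> \<le> A / 4 * measure ?M (E n)" using t_bound s by (intro mult_right_mono) auto
      finally show "(\<Sum>j\<in>{1..q} - J. K / t\<^sup>2 * ((real n)\<^sup>2 * measure ?M (E n))) \<le> A / 4 * measure ?M (E n)" .
    qed
    finally have "A * measure ?M (E n) \<le> A / 2 * measure ?M (E n)" by simp
    then show False using A s by simp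
  qed
  have "AE x in ?M. \<forall>n. x \<notin> E n"
    unfolding AE_all_countable using E_sets E_null
    by (auto intro!: AE_not_in simp: null_sets_def emeasure_eq_measure)
  then have "AE x in ?M. max_over J (\<lambda>j. cmod (g j x)) \<ge> m"
  proof (rule AE_mp, intro AE_I2 impI)
    fix x assume x: "x \<in> space ?M" "\<forall>n. x \<notin> E n"
    \<comment> \<open>At a given point all |g_j| are finite, so only the condition on
      \<open>J\<close> can keep x out of \<open>E n\<close>. For empty \<open>J\<close> this is
      contradictory, so \<Omega> is null and the convention for the empty maximum does no
      harm.\<close>
    obtain n :: nat where n: "(\<Sum>j\<in>{1..q}. cmod (g j x)) \<le> real n" using real_arch_simple by blast
    have "cmod (g j x) \<le> real n" if "j \<in> {1..q}" for j
      using member_le_sum[OF that, of "\<lambda>j. cmod (g j x)"] n by simp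
    moreover have "x \<notin> E n" using x(2) by blast
    ultimately obtain j where "j \<in> J" "m \<le> cmod (g j x)"
      using x(1) by (auto simp: E_def not_less)
    then show "max_over J (\<lambda>j. cmod (g j x)) \<ge> m"
      using J_fin unfolding max_over_def by (auto simp: Max_ge_iff)
  qed
  then show ?thesis using m(1) by blast
qed

section \<open>Sufficiency of the lower bound\<close>

text \<open>With the lattice for the indices in \<open>J\<close>, Parseval turns the frame sum into
  V times the integral of |f|^2 against the sum of |g_j|^2 over \<open>J\<close>. Frame bounds thus
  reduce to pointwise bounds for that sum: m^2 from below and the sum of the squared essential
  bounds from above.\<close>

lemma max_lower_bound_imp_frame:
  fixes g :: "nat \<Rightarrow> real ^ 'd \<Rightarrow> complex"
  assumes \<Omega>: "bounded \<Omega>" "\<Omega> \<in> sets lebesgue"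
    and g: "\<And>j. j \<in> {1..q} \<Longrightarrow> g j \<in> L2 \<Omega>"
    and J: "J = {j \<in> {1..q}. Linf_norm \<Omega> (g j) < \<infinity>}"
    and m: "m > 0" "AE x in lebesgue_on \<Omega>. max_over J (\<lambda>j. cmod (g j x)) \<ge> m"
  shows "\<exists>\<Lambda>. (\<forall>j\<in>{1..q}. countable (\<Lambda> j)) \<and> is_weighted_exp_frame \<Omega> q g \<Lambda>"
proof -
  let ?M = "lebesgue_on \<Omega>"
  obtain N where N: "N > 0" "\<Omega> \<subseteq> cube N" using bounded_subset_cube[OF \<Omega>(1)] .
  define V where "V = (2 * N) ^ CARD('d)"
  have V: "V > 0" using N by (simp add: V_def)
  have J_sub: "J \<subseteq> {1..q}" and J_fin: "finite J" using J by auto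
  define \<Lambda> where "\<Lambda> j = (if j \<in> J then lat N else {} :: (real ^ 'd) set)" for j :: nat
  have gm: "g j \<in> borel_measurable ?M" if "j \<in> J" for j
    using L2_measurable[OF g[OF subsetD[OF J_sub that]]] .
  have "\<exists>C. AE x in ?M. cmod (g j x) \<le> C" if j: "j \<in> J" for j
  proof -
    obtain C where C: "Linf_norm \<Omega> (g j) = ennreal C" "C \<ge> 0"
      using j J by (cases "Linf_norm \<Omega> (g j)") auto
    have "AE x in ?M. ennreal (cmod (g j x)) \<le> ennreal C"
      using esssup_AE[where M = ?M and f = "\<lambda>x. ennreal (cmod (g j x))"] C unfolding Linf_norm_def by simp
    then show ?thesis using C(2) by (auto simp: ennreal_le_iff)
  qed
  then obtain C where C: "\<And>j. j \<in> J \<Longrightarrow> AE x in ?M. cmod (g j x) \<le> C j" by metis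
  \<comment> \<open>The 1 added to the sum of squares keeps the upper constant positive even if that
    sum is 0.\<close>
  have frame: "ennreal (V * m\<^sup>2 * (L2_norm \<Omega> f)\<^sup>2)
      \<le> (\<Sum>j = 1..q. \<Sum>\<^sub>\<infinity>l\<in>\<Lambda> j. ennreal ((cmod (L2_inner \<Omega> f (weighted_exp (g j) l)))\<^sup>2)) \<and>
      (\<Sum>j = 1..q. \<Sum>\<^sub>\<infinity>l\<in>\<Lambda> j. ennreal ((cmod (L2_inner \<Omega> f (weighted_exp (g j) l)))\<^sup>2))
      \<le> ennreal (V * ((\<Sum>j\<in>J. (C j)\<^sup>2) + 1) * (L2_norm \<Omega> f)\<^sup>2)"
    if f: "f \<in> L2 \<Omega>" for f
  proof -
    have fg: "(\<lambda>x. f x * cnj (g j x)) \<in> L2 \<Omega>" if "j \<in> J" for j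
      using gm[OF that] C[OF that] by (intro L2_bounded_mult[OF f, where C = "C j"]) auto
    have int: "integrable ?M (\<lambda>x. (cmod (f x))\<^sup>2 * (cmod (g j x))\<^sup>2)" if "j \<in> J" for j
      using L2_integrable[OF fg[OF that]] by (simp add: norm_mult power_mult_distrib)
    have "(\<Sum>j = 1..q. \<Sum>\<^sub>\<infinity>l\<in>\<Lambda> j. ennreal ((cmod (L2_inner \<Omega> f (weighted_exp (g j) l)))\<^sup>2))
        = (\<Sum>j\<in>J. \<Sum>\<^sub>\<infinity>l\<in>lat N. ennreal ((cmod (ft \<Omega> (\<lambda>x. f x * cnj (g j x)) l))\<^sup>2))"
      using J_sub unfolding L2_inner_weighted_exp
      by (intro sum.mono_neutral_cong_right) (auto simp: \<Lambda>_def)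
    also have "\<dots> = (\<Sum>j\<in>J. ennreal (V * (L2_norm \<Omega> (\<lambda>x. f x * cnj (g j x)))\<^sup>2))"
      unfolding V_def by (intro sum.cong refl parseval N \<Omega> fg)
    also have "\<dots> = ennreal (V * (\<Sum>j\<in>J. (LINT x|?M. (cmod (f x))\<^sup>2 * (cmod (g j x))\<^sup>2)))"
      using V by (subst sum_ennreal) (auto simp: L2_norm_power2 norm_mult power_mult_distrib sum_distrib_left)
    also have "(\<Sum>j\<in>J. (LINT x|?M. (cmod (f x))\<^sup>2 * (cmod (g j x))\<^sup>2))
        = (LINT x|?M. (\<Sum>j\<in>J. (cmod (f x))\<^sup>2 * (cmod (g j x))\<^sup>2))"
      by (rule Bochner_Integration.integral_sum[symmetric]) (rule int)
    finally have eq: "(\<Sum>j = 1..q. \<Sum>\<^sub>\<infinity>l\<in>\<Lambda> j. ennreal ((cmod (L2_inner \<Omega> f (weighted_exp (g j) l)))\<^sup>2))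
        = ennreal (V * (LINT x|?M. (\<Sum>j\<in>J. (cmod (f x))\<^sup>2 * (cmod (g j x))\<^sup>2)))" .
    have "(LINT x|?M. m\<^sup>2 * (cmod (f x))\<^sup>2) \<le> (LINT x|?M. (\<Sum>j\<in>J. (cmod (f x))\<^sup>2 * (cmod (g j x))\<^sup>2))"
    proof (rule integral_mono_AE)
      show "AE x in ?M. m\<^sup>2 * (cmod (f x))\<^sup>2 \<le> (\<Sum>j\<in>J. (cmod (f x))\<^sup>2 * (cmod (g j x))\<^sup>2)"
        using m(2)
      proof eventually_elim
        case (elim x)
        \<comment> \<open>An empty maximum is 0, hence below m. The argument is made at a point x
          because \<open>J\<close> may be empty if \<Omega> is null.\<close>
        then have "J \<noteq> {}" using m(1) by (auto simp: max_over_def)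
        then obtain j where j: "j \<in> J" "m \<le> cmod (g j x)"
          using elim J_fin by (auto simp: max_over_def Max_ge_iff)
        then have "m\<^sup>2 \<le> (cmod (g j x))\<^sup>2" using m(1) by (intro power_mono) auto
        also have "\<dots> \<le> (\<Sum>j\<in>J. (cmod (g j x))\<^sup>2)" using j J_fin by (intro member_le_sum) auto
        finally have "(cmod (f x))\<^sup>2 * m\<^sup>2 \<le> (cmod (f x))\<^sup>2 * (\<Sum>j\<in>J. (cmod (g j x))\<^sup>2)"
          by (rule mult_left_mono) simp
        then show ?case by (simp only: sum_distrib_left mult.commute)
      qed
    qed (use L2_integrable[OF f] int in auto)
    then have lo: "m\<^sup>2 * (L2_norm \<Omega> f)\<^sup>2 \<le> (LINT x|?M. (\<Sum>j\<in>J. (cmod (f x))\<^sup>2 * (cmod (g j x))\<^sup>2))"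
      by (simp add: L2_norm_power2)
    have "AE x in ?M. \<forall>j\<in>J. cmod (g j x) \<le> C j"
      using C J_fin by (intro AE_finite_allI) auto
    then have "(LINT x|?M. (\<Sum>j\<in>J. (cmod (f x))\<^sup>2 * (cmod (g j x))\<^sup>2))
        \<le> (LINT x|?M. (\<Sum>j\<in>J. (C j)\<^sup>2) * (cmod (f x))\<^sup>2)"
    proof (intro integral_mono_AE)
      show "AE x in ?M. (\<Sum>j\<in>J. (cmod (f x))\<^sup>2 * (cmod (g j x))\<^sup>2) \<le> (\<Sum>j\<in>J. (C j)\<^sup>2) * (cmod (f x))\<^sup>2"
        if "AE x in ?M. \<forall>j\<in>J. cmod (g j x) \<le> C j"
        using that
      proof eventually_elim
        case (elim x)
        then have "(\<Sum>j\<in>J. (cmod (g j x))\<^sup>2) \<le> (\<Sum>j\<in>J. (C j)\<^sup>2)"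
          by (intro sum_mono power_mono) auto
        then show ?case by (simp add: sum_distrib_left[symmetric] mult.commute mult_left_mono)
      qed
    qed (use L2_integrable[OF f] int in auto)
    then have "(LINT x|?M. (\<Sum>j\<in>J. (cmod (f x))\<^sup>2 * (cmod (g j x))\<^sup>2)) \<le> (\<Sum>j\<in>J. (C j)\<^sup>2) * (L2_norm \<Omega> f)\<^sup>2"
      by (simp add: L2_norm_power2)
    also have "\<dots> \<le> ((\<Sum>j\<in>J. (C j)\<^sup>2) + 1) * (L2_norm \<Omega> f)\<^sup>2"
      by (intro mult_right_mono) auto
    finally show ?thesis
      unfolding eq using lo V by (auto simp: mult.assoc intro!: ennreal_leI mult_left_mono)
  qed
  have "V * m\<^sup>2 > 0" "V * ((\<Sum>j\<in>J. (C j)\<^sup>2) + 1) > 0"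
    using V m(1) by (auto intro!: mult_pos_pos add_nonneg_pos sum_nonneg)
  then have "is_weighted_exp_frame \<Omega> q g \<Lambda>"
    unfolding is_weighted_exp_frame_def using frame by blast
  moreover have "\<forall>j\<in>{1..q}. countable (\<Lambda> j)" by (simp add: \<Lambda>_def lat_countable N)
  ultimately show ?thesis by blast
qed

theorem theorem1p2:
  fixes \<Omega> :: "(real ^ 'd) set"
    and q :: nat
    and g :: "nat \<Rightarrow> real ^ 'd \<Rightarrow> complex"
    and J :: "nat set"
  assumes "bounded \<Omega>"
    and "\<Omega> \<in> sets lebesgue"
    and "\<And>j. j \<in> {1..q} \<Longrightarrow> g j \<in> L2 \<Omega> - L2_zero \<Omega>"
    and "J = {j \<in> {1..q}. Linf_norm \<Omega> (g j) < \<infinity>}"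
  shows "(\<exists>\<Lambda> :: nat \<Rightarrow> (real ^ 'd) set.
            (\<forall>j \<in> {1..q}. countable (\<Lambda> j)) \<and> is_weighted_exp_frame \<Omega> q g \<Lambda>)
         \<longleftrightarrow>
         (\<exists>m > 0. AE x in lebesgue_on \<Omega>. max_over J (\<lambda>j. cmod (g j x)) \<ge> m)"
  using frame_imp_max_lower_bound[OF assms] max_lower_bound_imp_frame[OF assms(1,2) _ assms(4)] assms(3)
  by (meson DiffD1)

end
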